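(* Let $S$ be a Polish space with Borel $\sigma$-field $\mathcal{B}$, let $\lambda$ be a $\sigma$-finite measure on $\mathcal{B}$, and let $X=(X_1,X_2,\ldots)$ be a conditionally identically distributed (c.i.d.) sequence of $S$-valued random variables on a probability space $(\Omega,\mathcal{A},P)$ such that $\mathcal{L}(X_1,\ldots,X_n)\ll\lambda^n$ for all $n\geq 1$. Let $\alpha_n$ ($n\ge 0$) be the predictive measures of $X$, chosen so that $\alpha_n(\omega)(dx)=f_n(\omega,x)\,\lambda(dx)$ for all $\omega\in\Omega$ and $n\geq 0$, with $f_n:\Omega\times S\to[0,\infty)$, and let $\alpha$ be the random probability measure on $S$ with $\alpha_n\to\alpha$ weakly a.s. Let $\mathcal{K}$ be the collection of compact sets $K\subset S$ with $\lambda(K)<\infty$, and for $K\in\mathcal{K}$ let $\lambda_K(\cdot)=\lambda(\cdot\cap K)$. Then $\alpha(\omega)\ll\lambda$ for $P$-almost all $\omega$ if and only if, for each $K\in\mathcal{K}$, for almost all $\omega\in\Omega$ the sequence $(f_n(\omega,\cdot): n\geq 1)$ is uniformly integrable in the space $(S,\mathcal{B},\lambda_K)$. In particular, $\alpha\ll\lambda$ a.s. provided, for each $K\in\mathcal{K}$, there is $p>1$ such that $$\sup_n\int_K f_n(\omega,x)^p\,\lambda(dx)<\infty\quad\text{for almost all }\omega\in\Omega.\qquad( ** )$$ Moreover, for condition $( ** )$ to be true (for given $K\in\mathcal{K}$ and $p>1$), it suffices that $$\sup_n E\left\{\int_K f_n^p\,d\lambda\right\}<\infty .$$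
   Context: Let $\mathbb{S}$ be the set of probability measures on $\mathcal{B}$. A random probability measure on $S$ is a map $\alpha:\Omega\to\mathbb{S}$ such that $\omega\mapsto\alpha(\omega)(B)$ is $\mathcal{A}$-measurable for every $B\in\mathcal{B}$; $\sigma(\alpha)$ is the $\sigma$-field on $\Omega$ generated by these maps. The sequence $X$ is conditionally identically distributed (c.i.d.) if $(X_1,\ldots,X_n,X_{n+2})$ and $(X_1,\ldots,X_n,X_{n+1})$ have the same distribution for every $n\geq 0$ (for $n=0$: $X_2\sim X_1$). Let $\mathcal{G}_0=\{\varnothing,\Omega\}$, $\mathcal{G}_n=\sigma(X_1,\ldots,X_n)$ for $n\ge1$, $\mathcal{G}_\infty=\sigma(\bigcup_n\mathcal{G}_n)$. For $n\geq1$ the $n$th predictive measure $\alpha_n$ is a random probability measure on $S$ such that, for every $B\in\mathcal{B}$, $\alpha_n(\cdot)(B)$ is a version of $P(X_{n+1}\in B\mid X_1,\ldots,X_n)$; also $\alpha_0(\cdot)=P(X_1\in\cdot)$. Known fact (background): if $X$ is c.i.d., there is a random probability measure $\alpha$ on $S$ such that $\sigma(\alpha)\subset\mathcal{G}_\infty$ and, for every $B\in\mathcal{B}$ and $n\ge 0$, $\alpha_n(B)=E\{\alpha(B)\mid\mathcal{G}_n\}$ a.s.; in particular $\alpha_n(\omega)\to\alpha(\omega)$ weakly for almost all $\omega$, so $\alpha$ is determined up to a $P$-null set. This is the $\alpha$ in the claim (with $\sigma(\alpha)\subset\mathcal{G}_\infty$). $\mathcal{L}(\cdot)$ denotes probability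 distribution under $P$, and $\lambda^n=\lambda\times\cdots\times\lambda$ ($n$ factors). The condition $\mathcal{L}(X_1,\ldots,X_n)\ll\lambda^n$ for all $n\ge1$ is equivalent to $\alpha_n\ll\lambda$ a.s. for all $n\geq0$; hence, after modifying each $\alpha_n$ on a $P$-null set, $\alpha_n(\omega)$ has a density $f_n(\omega,\cdot)$ with respect to $\lambda$ for every $\omega\in\Omega$ and $n\ge 0$ (since $\mathcal{B}$ is countably generated, $f_n$ can be taken $\mathcal{A}\otimes\mathcal{B}$-measurable). A sequence $(g_n)$ of nonnegative Borel functions is uniformly integrable in $(S,\mathcal{B},\lambda_K)$ if $\lim_{c\to\infty}\sup_n\int_{\{g_n>c\}}g_n\,d\lambda_K=0$ (note that $\lambda_K$ is a finite measure). *)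

theory Defs
  imports "HOL-Probability.Probability"
begin

(* Sequences of random variables are indexed from 1: X 1, X 2, ...; the value X 0 is never used. *)

definition initial_segment :: "(nat \<Rightarrow> 'w \<Rightarrow> 'a) \<Rightarrow> nat \<Rightarrow> 'w \<Rightarrow> nat \<Rightarrow> 'a" where
  "initial_segment X n \<omega> = (\<lambda>i\<in>{1..n}. X i \<omega>)"

(* The two laws compared are those of (X 1, ..., X n, X (n+2)) and (X 1, ..., X n, X (n+1)). *)
definition cond_ident_distr :: "'w measure \<Rightarrow> (nat \<Rightarrow> 'w \<Rightarrow> 'a::topological_space) \<Rightarrow> bool" where
  "cond_ident_distr M X \<longleftrightarrow>
    (\<forall>n. distr M (Pi\<^sub>M {1..n+1} (\<lambda>_. borel)) (\<lambda>\<omega>. \<lambda>i\<in>{1..n+1}. if i = n+1 then X (n+2) \<omega> else X i \<omega>)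
       = distr M (Pi\<^sub>M {1..n+1} (\<lambda>_. borel)) (initial_segment X (n+1)))"

(* For n = 0 the product has a one-point space, so this is the trivial sigma-field. *)
definition past :: "'w measure \<Rightarrow> (nat \<Rightarrow> 'w \<Rightarrow> 'a::topological_space) \<Rightarrow> nat \<Rightarrow> 'w measure" where
  "past M X n = vimage_algebra (space M) (initial_segment X n) (Pi\<^sub>M {1..n} (\<lambda>_. borel))"

definition past_infinity :: "'w measure \<Rightarrow> (nat \<Rightarrow> 'w \<Rightarrow> 'a::topological_space) \<Rightarrow> 'w measure" where
  "past_infinity M X = sigma (space M) (\<Union>n. sets (past M X n))"

(* A random probability measure is a measurable map into prob_algebra borel, whose sigma-field is
   generated by the evaluations at Borel sets.  Being a version of the conditional probability is
   understood up to null sets of M, so for n >= 1 the measure may have been modified on a null set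
   that does not belong to past M X n. *)
definition predictive_measures ::
    "'w measure \<Rightarrow> (nat \<Rightarrow> 'w \<Rightarrow> 'a::topological_space) \<Rightarrow> (nat \<Rightarrow> 'w \<Rightarrow> 'a measure) \<Rightarrow> bool" where
  "predictive_measures M X \<alpha>s \<longleftrightarrow>
    (\<forall>n. \<alpha>s n \<in> M \<rightarrow>\<^sub>M prob_algebra borel) \<and>
    (\<forall>\<omega>\<in>space M. \<alpha>s 0 \<omega> = distr M borel (X 1)) \<and>
    (\<forall>n\<ge>1. \<forall>B\<in>sets borel. AE \<omega> in M.
        measure (\<alpha>s n \<omega>) B = real_cond_exp M (past M X n) (\<lambda>\<omega>. indicat_real B (X (n+1) \<omega>)) \<omega>)"

definition converges_weakly :: "(nat \<Rightarrow> 'a::topological_space measure) \<Rightarrow> 'a measure \<Rightarrow> bool" where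
  "converges_weakly \<mu>s \<mu> \<longleftrightarrow>
    (\<forall>h::'a \<Rightarrow> real. continuous_on UNIV h \<and> bounded (range h) \<longrightarrow>
      (\<lambda>n. \<integral>x. h x \<partial>\<mu>s n) \<longlonglongrightarrow> (\<integral>x. h x \<partial>\<mu>))"

definition trace_measure :: "'a measure \<Rightarrow> 'a set \<Rightarrow> 'a measure" where
  "trace_measure N K = density N (indicator K)"

lemma emeasure_trace_measure:
  assumes "K \<in> sets N" "B \<in> sets N"
  shows "emeasure (trace_measure N K) B = emeasure N (B \<inter> K)"
proof -
  have "emeasure (trace_measure N K) B = (\<integral>\<^sup>+x. indicator K x * indicator B x \<partial>N)"
    unfolding trace_measure_def using assms by (intro emeasure_density) auto
  also have "\<dots> = (\<integral>\<^sup>+x. indicator (B \<inter> K) x \<partial>N)"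
    by (intro nn_integral_cong) (auto split: split_indicator)
  also have "\<dots> = emeasure N (B \<inter> K)"
    using assms by (intro nn_integral_indicator) auto
  finally show ?thesis .
qed

definition uniformly_integrable :: "'a measure \<Rightarrow> nat set \<Rightarrow> (nat \<Rightarrow> 'a \<Rightarrow> real) \<Rightarrow> bool" where
  "uniformly_integrable N I g \<longleftrightarrow>
    ((\<lambda>c::real. SUP n\<in>I. \<integral>\<^sup>+x\<in>{x. g n x > c}. ennreal (g n x) \<partial>N) \<longlongrightarrow> 0) at_top"

end

theory Submission
  imports Defs
begin

text \<open>
  Letting \<open>k\<close> tend to infinity in \<open>P(A \<inter> {X (k+1) \<in> B}) = P(A \<inter> {X (n+1) \<in> B})\<close>, for \<open>A\<close> in the \<open>n\<close>-th past,
  shows that \<open>\<alpha>s n B\<close> is the conditional expectation of \<open>\<alpha> B\<close> given the first \<open>n\<close> variables.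
  Everything else only uses this measure-valued martingale.

  Uniform integrability on a compact \<open>K\<close> means that the measures \<open>\<alpha>s n\<close> restricted to \<open>K\<close> are uniformly
  absolutely continuous, which by outer regularity has to be checked only on a countable family of open sets.
  If \<open>\<alpha>\<close> is almost surely absolutely continuous, then \<open>Z d\<close>, the supremum of \<open>\<alpha> (V \<inter> K)\<close> over the members
  \<open>V\<close> of this family with \<open>lam (V \<inter> K) < d\<close>, tends to \<open>0\<close> with \<open>d\<close>; as \<open>\<alpha>s n (V \<inter> K)\<close> is at most the
  conditional expectation of \<open>Z d\<close>, the maximal inequality gives a bound uniform in \<open>n\<close>.  Conversely,
  \<open>\<alpha> C \<le> (SUP n. \<alpha>s n C)\<close> almost surely for each Borel set \<open>C\<close> because \<open>\<alpha>\<close> is measurable with respect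
  to the limit of the filtration, so that uniform absolute continuity passes to \<open>\<alpha>\<close>.

  For the moment condition, jointly measurable versions of the densities, adapted to the filtration, turn
  \<open>\<integral>\<^sub>K f\<^sub>n\<^sup>p\<close> into a submartingale bounded in mean.
\<close>

subsection \<open>Borel measures on Polish spaces\<close>

text \<open>The main obstacle is the order of quantifiers. Each conditional expectation identity
  holds off a null set that depends on the Borel set, whereas absolute continuity of
  \<open>\<alpha> \<omega>\<close> concerns all Borel sets at once. The identities are therefore
  used only for countably many sets V \<inter> K, with V and K not depending on \<omega>;
  regularity, available for each single \<omega>, reaches the other sets. In general V \<inter> K is
  neither open nor closed, so weak convergence does not control its measure. Weak convergence enters
  once, to identify \<open>\<alpha>s n\<close> with a conditional expectation of
  \<open>\<alpha>\<close>. The second obstacle is measurability. \<open>\<alpha>s n\<close> may have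
  been modified on a null set and so need not be adapted, and \<open>f n \<omega> x\<close> is
  assumed measurable in x only. Maximal inequalities need adapted processes, so they are applied to
  the versions \<open>nn_cond_exp\<close> and to Radon-Nikodym derivatives formed over the n-th
  sigma-field.\<close>

lemma open_union_of_countable_family:
  obtains \<V> :: "'a::second_countable_topology set set"
  where "countable \<V>" "\<And>V. V \<in> \<V> \<Longrightarrow> open V"
    "\<And>U. open U \<Longrightarrow> \<exists>W::nat \<Rightarrow> 'a set. range W \<subseteq> \<V> \<and> incseq W \<and> U = \<Union>(range W)"
proof -
  obtain B :: "'a set set" where B: "countable B" "topological_basis B"
    using ex_countable_basis by auto
  \<comment> \<open>Finite unions of basis sets, not the basis sets themselves: every open set then
    is an increasing union of members, so bounds and equalities pass to it by continuity from
    below.\<close>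
  define \<V> where "\<V> = Union ` {A. finite A \<and> A \<subseteq> B}"
  have "countable \<V>"
    unfolding \<V>_def using B(1) by (intro countable_image) (auto intro: countable_Collect_finite_subset)
  moreover have "open V" if "V \<in> \<V>" for V
    using that topological_basis_open[OF B(2)] by (auto simp: \<V>_def)
  moreover have "\<exists>W::nat \<Rightarrow> 'a set. range W \<subseteq> \<V> \<and> incseq W \<and> U = \<Union>(range W)" if U: "open U" for U
  proof -
    obtain C where C: "C \<subseteq> B" "\<Union>C = U"
      using B(2) U unfolding topological_basis_def by blast
    have cC: "countable C" using B(1) C(1) countable_subset by blast
    show ?thesis
    proof (cases "C = {}")
      case True
      then show ?thesis using C
        by (intro exI[of _ "\<lambda>_. {}"]) (auto simp: \<V>_def incseq_def image_iff intro!: exI[of _ "{}"])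
    next
      case False
      define W where "W n = (\<Union>i\<le>n. from_nat_into C i)" for n :: nat
      have "range W \<subseteq> \<V>"
      proof safe
        fix n
        have "W n = \<Union>(from_nat_into C ` {..n})" by (simp add: W_def)
        moreover have "from_nat_into C ` {..n} \<subseteq> B"
          using C(1) from_nat_into[OF False] by auto
        ultimately show "W n \<in> \<V>" unfolding \<V>_def by blast
      qed
      moreover have "incseq W" unfolding W_def incseq_def by force
      moreover have "U = \<Union>(range W)"
      proof -
        have "\<Union>(range W) = \<Union>(range (from_nat_into C))" by (auto simp: W_def)
        also have "range (from_nat_into C) = C" using False cC by (rule range_from_nat_into)
        finally show ?thesis using C by simp
      qed
      ultimately show ?thesis by blast
    qed
  qed
  ultimately show thesis by (rule that)
qed

lemma finite_borel_measure_eqI_open: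
  fixes \<mu> \<nu> :: "'a::topological_space measure"
  assumes "sets \<mu> = sets borel" "sets \<nu> = sets borel" "emeasure \<mu> UNIV \<noteq> \<infinity>"
    and "\<And>U. open U \<Longrightarrow> emeasure \<mu> U = emeasure \<nu> U"
  shows "\<mu> = \<nu>"
proof (rule measure_eqI_generator_eq[where \<Omega>=UNIV and E="{U. open U}" and A="\<lambda>_. UNIV"])
  show "Int_stable {U::'a set. open U}" by (auto simp: Int_stable_def)
qed (use assms in \<open>auto simp: sets_borel\<close>)

text \<open>With a countable family, almost sure equalities between two random measures, one for
  each set, combine into equality of the measures off a single null set.\<close>

lemma finite_borel_measure_eqI_countable:
  fixes \<mu> \<nu> :: "'a::topological_space measure"
  assumes sets: "sets \<mu> = sets borel" "sets \<nu> = sets borel" and fin: "emeasure \<mu> UNIV \<noteq> \<infinity>"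
    and \<V>: "\<And>V. V \<in> \<V> \<Longrightarrow> open V"
      "\<And>U. open U \<Longrightarrow> \<exists>W::nat \<Rightarrow> 'a set. range W \<subseteq> \<V> \<and> incseq W \<and> U = \<Union>(range W)"
    and eq: "\<And>V. V \<in> \<V> \<Longrightarrow> emeasure \<mu> V = emeasure \<nu> V"
  shows "\<mu> = \<nu>"
proof (rule finite_borel_measure_eqI_open[OF sets fin])
  fix U :: "'a set" assume "open U"
  then obtain W :: "nat \<Rightarrow> 'a set" where W: "range W \<subseteq> \<V>" "incseq W" "U = \<Union>(range W)"
    using \<V>(2) by blast
  have b: "range W \<subseteq> sets borel" using W(1) \<V>(1) by (auto intro!: borel_open)
  have "emeasure \<mu> U = (SUP n. emeasure \<mu> (W n))"
    unfolding W(3) using W(2) b sets by (intro SUP_emeasure_incseq[symmetric]) auto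
  also have "\<dots> = (SUP n. emeasure \<nu> (W n))"
    using W(1) eq by (intro SUP_cong) auto
  also have "\<dots> = emeasure \<nu> U"
    unfolding W(3) using W(2) b sets by (intro SUP_emeasure_incseq) auto
  finally show "emeasure \<mu> U = emeasure \<nu> U" .
qed

text \<open>The indicator of an open set is an increasing limit of continuous functions with values
  between 0 and 1, so testing with these, as weak convergence permits, determines a finite
  measure.\<close>

lemma finite_borel_measure_eqI_continuous:
  fixes \<mu> \<nu> :: "'a::metric_space measure"
  assumes sets: "sets \<mu> = sets borel" "sets \<nu> = sets borel" and fin: "emeasure \<mu> UNIV \<noteq> \<infinity>"
    and eq: "\<And>h::'a \<Rightarrow> real. continuous_on UNIV h \<Longrightarrow> (\<And>x. 0 \<le> h x) \<Longrightarrow> (\<And>x. h x \<le> 1) \<Longrightarrow>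
      (\<integral>\<^sup>+x. ennreal (h x) \<partial>\<mu>) = (\<integral>\<^sup>+x. ennreal (h x) \<partial>\<nu>)"
  shows "\<mu> = \<nu>"
proof (rule finite_borel_measure_eqI_open[OF sets fin])
  fix U :: "'a set" assume U: "open U"
  \<comment> \<open>Multiples of the distance to the complement, cut off at 1. The whole space is
    treated apart because \<open>infdist x {}\<close> is 0 by convention.\<close>
  define h where "h n x = (if U = UNIV then 1 else min 1 (real n * infdist x (- U)))" for n x
  have cont: "continuous_on UNIV (h n)" for n
    unfolding h_def by (cases "U = UNIV") (auto intro!: continuous_intros)
  have nonneg: "0 \<le> h n x" for n x by (auto simp: h_def infdist_nonneg)
  have le1: "h n x \<le> 1" for n x by (auto simp: h_def)
  have inc: "incseq (\<lambda>n x. ennreal (h n x))"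
  proof -
    have "real m * infdist x (- U) \<le> real n * infdist x (- U)" if "m \<le> n" for m n x
      using that by (intro mult_right_mono) (auto simp: infdist_nonneg)
    then show ?thesis
      by (auto simp: incseq_def le_fun_def h_def intro!: ennreal_leI min.mono)
  qed
  have sup: "(SUP n. ennreal (h n x)) = indicator U x" for x
  proof (cases "x \<in> U")
    case False
    then have "h n x = 0" for n by (auto simp: h_def)
    then show ?thesis using False by simp
  next
    case True
    have "\<exists>n. h n x = 1"
    proof (cases "U = UNIV")
      case False
      have pos: "infdist x (- U) > 0"
        using infdist_pos_not_in_closed[of "- U" x] U True False by (auto simp: closed_def)
      obtain n where "1 / infdist x (- U) \<le> real n" using real_arch_simple by blast
      then have "1 \<le> real n * infdist x (- U)" using pos by (simp add: divide_simps mult.commute)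
      then show ?thesis by (intro exI[of _ n]) (auto simp: h_def)
    qed (auto simp: h_def)
    then obtain n where "h n x = 1" by blast
    then have "(SUP n. ennreal (h n x)) \<ge> 1" by (intro SUP_upper2[of n]) auto
    moreover have "(SUP n. ennreal (h n x)) \<le> 1" using le1 by (intro SUP_least) auto
    ultimately show ?thesis using True by simp
  qed
  have *: "emeasure \<kappa> U = (SUP n. \<integral>\<^sup>+x. ennreal (h n x) \<partial>\<kappa>)" if s: "sets \<kappa> = sets borel" for \<kappa>
  proof -
    have [measurable]: "h n \<in> borel_measurable \<kappa>" for n
      using borel_measurable_continuous_onI[OF cont] s measurable_cong_sets by blast
    have "emeasure \<kappa> U = (\<integral>\<^sup>+x. indicator U x \<partial>\<kappa>)"
      using U s by (intro nn_integral_indicator[symmetric]) auto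
    also have "\<dots> = (\<integral>\<^sup>+x. (SUP n. ennreal (h n x)) \<partial>\<kappa>)" by (simp add: sup)
    also have "\<dots> = (SUP n. \<integral>\<^sup>+x. ennreal (h n x) \<partial>\<kappa>)"
      using inc by (intro nn_integral_monotone_convergence_SUP) auto
    finally show ?thesis .
  qed
  show "emeasure \<mu> U = emeasure \<nu> U"
    unfolding *[OF sets(1)] *[OF sets(2)] using eq[OF cont nonneg le1] by simp
qed

text \<open>By outer regularity of the finite measure \<open>\<rho>\<close>, the strict bound on
  \<open>B\<close> survives for some open superset. Members of \<open>\<V>\<close> exhausting that
  superset inherit it, so the bound on \<open>\<mu>\<close> rises to the open set by continuity from
  below and descends to \<open>B\<close> by monotonicity.\<close>

lemma emeasure_bound_borel_from_countable:
  fixes \<rho> \<mu> :: "'a::polish_space measure"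
  assumes sets: "sets \<rho> = sets borel" "sets \<mu> = sets borel" and fin: "emeasure \<rho> UNIV \<noteq> \<infinity>"
    and \<V>: "\<And>V. V \<in> \<V> \<Longrightarrow> open V"
      "\<And>U. open U \<Longrightarrow> \<exists>W::nat \<Rightarrow> 'a set. range W \<subseteq> \<V> \<and> incseq W \<and> U = \<Union>(range W)"
    and le: "\<And>V. V \<in> \<V> \<Longrightarrow> emeasure \<rho> V < \<delta> \<Longrightarrow> emeasure \<mu> V \<le> \<epsilon>"
    and B: "B \<in> sets borel" "emeasure \<rho> B < \<delta>"
  shows "emeasure \<mu> B \<le> \<epsilon>"
proof -
  have "space \<rho> = UNIV" using sets_eq_imp_space_eq[OF sets(1)] by simp
  then have "(INF U \<in> {U. B \<subseteq> U \<and> open U}. emeasure \<rho> U) < \<delta>"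
    using outer_regular[OF sets(1) _ B(1)] fin B(2) by simp
  then obtain U where U: "B \<subseteq> U" "open U" "emeasure \<rho> U < \<delta>"
    unfolding INF_less_iff by blast
  obtain W :: "nat \<Rightarrow> 'a set" where W: "range W \<subseteq> \<V>" "incseq W" "U = \<Union>(range W)"
    using \<V>(2)[OF U(2)] by blast
  have b: "range W \<subseteq> sets borel" using W(1) \<V>(1) by (auto intro!: borel_open)
  have "emeasure \<mu> B \<le> emeasure \<mu> U"
    using U B(1) sets by (intro emeasure_mono) auto
  also have "\<dots> = (SUP n. emeasure \<mu> (W n))"
    unfolding W(3) using W(2) b sets by (intro SUP_emeasure_incseq[symmetric]) auto
  also have "\<dots> \<le> \<epsilon>"
  proof (intro SUP_least le)
    fix n
    show "W n \<in> \<V>" using W(1) by auto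
    have "emeasure \<rho> (W n) \<le> emeasure \<rho> U"
      using W U(2) sets by (intro emeasure_mono) auto
    then show "emeasure \<rho> (W n) < \<delta>" using U(3) by simp
  qed
  finally show ?thesis .
qed

text \<open>Borel-Cantelli by contradiction: bad sets, one for each k, would have a limsup that is
  \<open>\<rho>\<close>-null and yet, \<open>\<mu>\<close> being finite, of \<open>\<mu>\<close>
  measure at least \<epsilon>. The dyadic thresholds are summable, and they let later suprema be
  indexed by natural numbers.\<close>

lemma absolutely_continuous_epsilon_delta:
  assumes \<rho>: "finite_measure \<rho>" and \<mu>: "finite_measure \<mu>" and sets: "sets \<mu> = sets \<rho>"
    and ac: "absolutely_continuous \<rho> \<mu>" and \<epsilon>: "0 < \<epsilon>"
  obtains k :: nat where "\<And>B. B \<in> sets \<rho> \<Longrightarrow> emeasure \<rho> B < ennreal ((1/2) ^ k) \<Longrightarrow> emeasure \<mu> B \<le> \<epsilon>"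
proof (rule ccontr)
  interpret \<rho>: finite_measure \<rho> by fact
  interpret \<mu>: finite_measure \<mu> by fact
  assume "\<not> thesis"
  then have "\<forall>k. \<exists>B. B \<in> sets \<rho> \<and> emeasure \<rho> B < ennreal ((1/2) ^ k) \<and> \<epsilon> < emeasure \<mu> B"
    using that by (meson not_le)
  then obtain A where A: "\<And>k. A k \<in> sets \<rho>" "\<And>k. emeasure \<rho> (A k) < ennreal ((1/2) ^ k)"
      "\<And>k. \<epsilon> < emeasure \<mu> (A k)"
    by metis
  have m: "measure \<rho> (A k) \<le> (1/2) ^ k" for k
    using less_imp_le[OF A(2)[of k]] by (simp add: \<rho>.emeasure_eq_measure ennreal_le_iff)
  have "limsup A \<in> null_sets \<rho>"
  proof (rule borel_cantelli_limsup1)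
    show "summable (\<lambda>k. measure \<rho> (A k))"
      by (rule summable_comparison_test'[of "\<lambda>k. (1/2::real)^k" 0]) (use m in \<open>auto intro: summable_geometric\<close>)
  qed (use A in \<open>auto simp: less_top[symmetric]\<close>)
  then have null: "emeasure \<mu> (limsup A) = 0"
    using ac by (auto simp: absolutely_continuous_def)
  have "emeasure \<mu> (limsup A) = (INF n. emeasure \<mu> (\<Union>k\<in>{n..}. A k))"
    unfolding limsup_INF_SUP using A(1) sets
    by (intro INF_emeasure_decseq[symmetric]) (auto simp: decseq_def intro!: UN_mono dest: order_trans)
  also have "\<dots> \<ge> \<epsilon>"
  proof (rule INF_greatest)
    fix n
    have "\<epsilon> \<le> emeasure \<mu> (A n)" using A(3)[of n] by simp
    also have "\<dots> \<le> emeasure \<mu> (\<Union>k\<in>{n..}. A k)"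
      using A(1) sets by (intro emeasure_mono) auto
    finally show "\<epsilon> \<le> emeasure \<mu> (\<Union>k\<in>{n..}. A k)" .
  qed
  finally show False using null \<epsilon> by simp
qed

text \<open>Countably many compact sets need not cover a Polish space, but they do so up to a null
  set: each piece of finite measure is filled from inside up to \<open>(1/2)^j\<close>, for every
  j.\<close>

lemma sigma_finite_exhausted_by_compacts:
  fixes lam :: "'a::polish_space measure"
  assumes sets: "sets lam = sets borel" and "sigma_finite_measure lam"
  obtains \<C> :: "'a set set" where "countable \<C>" "\<And>K. K \<in> \<C> \<Longrightarrow> compact K"
    "\<And>K. K \<in> \<C> \<Longrightarrow> emeasure lam K < \<infinity>" "emeasure lam (- \<Union>\<C>) = 0"
proof -
  interpret sigma_finite_measure lam by fact
  have sp: "space lam = UNIV" using sets_eq_imp_space_eq[OF sets] by simp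
  obtain A :: "nat \<Rightarrow> 'a set" where A: "range A \<subseteq> sets lam" "(\<Union>i. A i) = UNIV"
      "\<And>i. emeasure lam (A i) \<noteq> \<infinity>"
    using sigma_finite sp by metis
  have [measurable]: "A i \<in> sets lam" for i using A(1) by auto
  \<comment> \<open>Inner regularity by compact sets is applied to finite measures, hence the
    restrictions of \<open>lam\<close> to the pieces \<open>A i\<close>.\<close>
  define \<rho> where "\<rho> i = density lam (indicator (A i))" for i
  have \<rho>: "emeasure (\<rho> i) B = emeasure lam (A i \<inter> B)" if "B \<in> sets borel" for i B
    using that sets unfolding \<rho>_def by (subst emeasure_density)
      (auto simp: indicator_inter_arith[symmetric] intro!: nn_integral_indicator)
  have "\<exists>K. compact K \<and> K \<subseteq> A i \<and> emeasure lam (A i) \<le> emeasure lam K + ennreal ((1/2)^j)" for i j :: nat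
  proof -
    have s: "sets (\<rho> i) = sets borel" by (simp add: \<rho>_def sets)
    have Ab: "A i \<in> sets borel" using A(1) unfolding sets[symmetric] by blast
    have fin: "emeasure (\<rho> i) (space (\<rho> i)) \<noteq> \<infinity>"
      using A(3)[of i] \<rho>[of UNIV i] by (simp add: \<rho>_def sp)
    have eq: "emeasure (\<rho> i) (A i) = (SUP K \<in> {K. K \<subseteq> A i \<and> compact K}. emeasure (\<rho> i) K)"
      by (rule inner_regular[OF s fin Ab])
    have lt: "emeasure (\<rho> i) (A i) \<noteq> \<infinity>"
      using A(3)[of i] \<rho>[OF Ab] by simp
    have ne: "{K. K \<subseteq> A i \<and> compact K} \<noteq> {}" by (auto intro: exI[of _ "{}"])
    have "\<exists>K\<in>{K. K \<subseteq> A i \<and> compact K}. emeasure (\<rho> i) (A i) < emeasure (\<rho> i) K + ennreal ((1/2)^j)"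
      by (rule SUP_approx_ennreal[OF _ ne eq lt]) simp
    then obtain K where K: "compact K" "K \<subseteq> A i" "emeasure (\<rho> i) (A i) < emeasure (\<rho> i) K + ennreal ((1/2)^j)"
      by blast
    have "A i \<inter> K = K" using K by auto
    then show ?thesis using K(1,2) less_imp_le[OF K(3)] \<rho>[OF Ab, of i] \<rho>[OF borel_compact[OF K(1)], of i]
      by (intro exI[of _ K]) simp
  qed
  then obtain K where K: "\<And>i j. compact (K i j)" "\<And>i j. K i j \<subseteq> A i"
      "\<And>i j::nat. emeasure lam (A i) \<le> emeasure lam (K i j) + ennreal ((1/2)^j)"
    by metis
  have [measurable]: "K i j \<in> sets lam" for i j using K(1) by (auto simp: sets intro: borel_compact)
  have fin: "emeasure lam (K i j) < \<infinity>" for i j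
    using emeasure_mono[OF K(2)[of i j], of lam] A(3)[of i] by (auto simp: less_top[symmetric] top_unique)
  have "emeasure lam (A i - (\<Union>j. K i j)) = 0" for i
  proof (rule ccontr)
    assume ne: "emeasure lam (A i - (\<Union>j. K i j)) \<noteq> 0"
    have "emeasure lam (A i - (\<Union>j. K i j)) \<le> ennreal ((1/2)^j)" for j
    proof -
      have "emeasure lam (A i - (\<Union>j. K i j)) \<le> emeasure lam (A i - K i j)"
        by (intro emeasure_mono) auto
      also have "\<dots> = emeasure lam (A i) - emeasure lam (K i j)"
        using fin[of i j] K(2) by (intro emeasure_Diff) auto
      also have "\<dots> \<le> ennreal ((1/2)^j)"
        using K(3)[of i j] fin[of i j] A(3)[of i] by (auto simp: ennreal_minus_le_iff)
      finally show ?thesis .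
    qed
    moreover have "(\<lambda>j. ennreal ((1/2)^j)) \<longlonglongrightarrow> ennreal 0"
      by (intro tendsto_ennrealI LIMSEQ_realpow_zero) auto
    ultimately have "emeasure lam (A i - (\<Union>j. K i j)) \<le> ennreal 0"
      by (intro LIMSEQ_le_const) auto
    then show False using ne by simp
  qed
  then have 0: "emeasure lam (\<Union>i. A i - (\<Union>j. K i j)) = 0"
    by (intro emeasure_UN_eq_0) auto
  have "- \<Union>(range (case_prod K)) \<subseteq> (\<Union>i. A i - (\<Union>j. K i j))"
    using A(2) by (fastforce simp: set_eq_iff)
  then have "emeasure lam (- \<Union>(range (case_prod K))) = 0"
    by (rule emeasure_eq_0[OF _ 0, rotated]) auto
  then show thesis
    by (intro that[of "range (case_prod K)"]) (use K(1) fin in auto)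
qed

subsection \<open>Uniform integrability and uniform absolute continuity\<close>

lemma sets_trace_measure [simp]: "sets (trace_measure N K) = sets N"
  by (simp add: trace_measure_def)

lemma space_trace_measure [simp]: "space (trace_measure N K) = space N"
  by (simp add: trace_measure_def)

lemma nn_integral_trace_measure:
  assumes "K \<in> sets N" "g \<in> borel_measurable N"
  shows "(\<integral>\<^sup>+x. g x \<partial>trace_measure N K) = (\<integral>\<^sup>+x\<in>K. g x \<partial>N)"
  using assms unfolding trace_measure_def
  by (subst nn_integral_density) (auto simp: mult.commute)

lemma emeasure_density_Int:
  assumes [measurable]: "g \<in> borel_measurable N" "B \<in> sets N" "K \<in> sets N"
  shows "emeasure (density N g) (B \<inter> K) = (\<integral>\<^sup>+x\<in>B. g x \<partial>trace_measure N K)"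
  by (subst emeasure_density) (auto simp: nn_integral_trace_measure intro!: nn_integral_cong split: split_indicator)

text \<open>On \<open>B\<close> the function is at most its part above a level plus the level
  itself. Uniform integrability provides one level for all indices, so the threshold
  \<open>d\<close> does not depend on \<open>n\<close>.\<close>

lemma uniformly_integrableD:
  assumes ui: "uniformly_integrable (trace_measure N K) I g"
    and K: "K \<in> sets N" and meas: "\<And>n. n \<in> I \<Longrightarrow> g n \<in> borel_measurable N" and "0 < e"
  obtains d :: real where "0 < d"
    "\<And>n B. n \<in> I \<Longrightarrow> B \<in> sets N \<Longrightarrow> emeasure N (B \<inter> K) < ennreal d \<Longrightarrow>
      emeasure (density N (\<lambda>x. ennreal (g n x))) (B \<inter> K) \<le> ennreal e"
proof -
  note [measurable] = K
  have "\<forall>\<^sub>F c in at_top. (SUP n\<in>I. \<integral>\<^sup>+x\<in>{x. g n x > c}. ennreal (g n x) \<partial>trace_measure N K) < ennreal (e/2)"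
    using order_tendstoD(2)[OF ui[unfolded uniformly_integrable_def]] \<open>0 < e\<close> by simp
  from eventually_conj[OF this eventually_gt_at_top[of 0]] obtain c :: real where c: "0 < c"
    "(SUP n\<in>I. \<integral>\<^sup>+x\<in>{x. g n x > c}. ennreal (g n x) \<partial>trace_measure N K) < ennreal (e/2)"
    unfolding eventually_at_top_linorder by auto
  show thesis
  \<comment> \<open>With this threshold the part below the level contributes at most
    \<open>c * (e / (2 * c))\<close>, which is half of \<open>e\<close>; the tail above
    \<open>c\<close> contributes the other half.\<close>
  proof (rule that[of "e / (2 * c)"])
    show "0 < e / (2 * c)" using c \<open>0 < e\<close> by simp
    fix n B assume n: "n \<in> I" and B [measurable]: "B \<in> sets N" and lt: "emeasure N (B \<inter> K) < ennreal (e / (2 * c))"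
    note [measurable] = meas[OF n]
    let ?\<rho> = "trace_measure N K"
    have "emeasure (density N (\<lambda>x. ennreal (g n x))) (B \<inter> K) = (\<integral>\<^sup>+x\<in>B. ennreal (g n x) \<partial>?\<rho>)"
      by (rule emeasure_density_Int) auto
    also have "\<dots> \<le> (\<integral>\<^sup>+x. ennreal (g n x) * indicator {x. g n x > c} x + ennreal c * indicator B x \<partial>?\<rho>)"
      by (intro nn_integral_mono) (auto split: split_indicator intro!: ennreal_leI simp: add_increasing)
    also have "\<dots> = (\<integral>\<^sup>+x\<in>{x. g n x > c}. ennreal (g n x) \<partial>?\<rho>) + (\<integral>\<^sup>+x. ennreal c * indicator B x \<partial>?\<rho>)"
    proof (rule nn_integral_add)
      have "(\<lambda>x. ennreal (g n x) * indicator {x\<in>space N. g n x > c} x) \<in> borel_measurable ?\<rho>"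
        by (simp add: trace_measure_def)
      then show "(\<lambda>x. ennreal (g n x) * indicator {x. g n x > c} x) \<in> borel_measurable ?\<rho>"
        by (rule measurable_cong[THEN iffD1, rotated]) (auto simp: split: split_indicator)
    qed (auto simp: trace_measure_def)
    also have "\<dots> \<le> ennreal (e/2) + ennreal c * ennreal (e / (2 * c))"
    proof (intro add_mono)
      show "(\<integral>\<^sup>+x\<in>{x. g n x > c}. ennreal (g n x) \<partial>?\<rho>) \<le> ennreal (e/2)"
        using n by (intro order_trans[OF SUP_upper less_imp_le[OF c(2)]])
      have "(\<integral>\<^sup>+x. ennreal c * indicator B x \<partial>?\<rho>) = ennreal c * emeasure N (B \<inter> K)"
        by (subst nn_integral_cmult_indicator) (auto simp: emeasure_trace_measure)
      also have "\<dots> \<le> ennreal c * ennreal (e / (2 * c))"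
        using lt by (intro mult_left_mono) auto
      finally show "(\<integral>\<^sup>+x. ennreal c * indicator B x \<partial>?\<rho>) \<le> ennreal c * ennreal (e / (2 * c))" .
    qed
    also have "\<dots> = ennreal e"
      using c \<open>0 < e\<close> by (simp add: ennreal_mult[symmetric] ennreal_plus[symmetric] field_simps del: ennreal_plus)
    finally show "emeasure (density N (\<lambda>x. ennreal (g n x))) (B \<inter> K) \<le> ennreal e" .
  qed
qed

lemma ennreal_tendsto_0I:
  fixes F :: "real \<Rightarrow> ennreal"
  assumes "\<And>e::real. 0 < e \<Longrightarrow> \<forall>\<^sub>F c in at_top. F c \<le> ennreal e"
  shows "(F \<longlongrightarrow> 0) at_top"
proof (rule order_tendstoI)
  fix a :: ennreal assume a: "0 < a"
  obtain r :: real where r: "0 < r" "ennreal r < a"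
  proof (cases a)
    case (real x)
    then show thesis using a by (intro that[of "x / 2"]) (auto intro!: ennreal_lessI)
  qed (use that[of 1] in auto)
  show "\<forall>\<^sub>F c in at_top. F c < a"
    using assms[OF r(1)] by eventually_elim (use r in auto)
qed simp

text \<open>By Markov's inequality and the mass bound \<open>prob\<close>, the part of
  \<open>K\<close> where \<open>g n\<close> exceeds \<open>c\<close> has measure at most
  \<open>1 / c\<close>. For \<open>c > 1 / d\<close> all these tail sets fall under the assumption
  \<open>ed\<close>.\<close>

lemma uniformly_integrableI:
  assumes K: "K \<in> sets N" and meas: "\<And>n. n \<in> I \<Longrightarrow> g n \<in> borel_measurable N"
    and prob: "\<And>n. n \<in> I \<Longrightarrow> emeasure (density N (\<lambda>x. ennreal (g n x))) (space N) \<le> 1"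
    and ed: "\<And>e::real. 0 < e \<Longrightarrow> \<exists>d::real>0. \<forall>n\<in>I. \<forall>B\<in>sets N. emeasure N (B \<inter> K) < ennreal d \<longrightarrow>
      emeasure (density N (\<lambda>x. ennreal (g n x))) (B \<inter> K) \<le> ennreal e"
  shows "uniformly_integrable (trace_measure N K) I g"
  unfolding uniformly_integrable_def
proof (rule ennreal_tendsto_0I)
  fix e :: real assume "0 < e"
  from ed[OF this] obtain d :: real where "0 < d" and *: "\<forall>n\<in>I. \<forall>B\<in>sets N. emeasure N (B \<inter> K) < ennreal d \<longrightarrow>
      emeasure (density N (\<lambda>x. ennreal (g n x))) (B \<inter> K) \<le> ennreal e"
    by (elim exE conjE)
  note d = \<open>0 < d\<close> *[rule_format]
  show "\<forall>\<^sub>F c in at_top. (SUP n\<in>I. \<integral>\<^sup>+x\<in>{x. g n x > c}. ennreal (g n x) \<partial>trace_measure N K) \<le> ennreal e"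
    using eventually_gt_at_top[of "1/d"]
  proof eventually_elim
    case (elim c)
    have "0 < 1 / d" using d(1) by simp
    with elim have c: "0 < c" by (rule order_less_trans[rotated])
    have c': "1 / c < d" using elim c d(1) by (simp add: divide_less_eq mult.commute)
    show ?case
    proof (rule SUP_least)
      fix n assume n: "n \<in> I"
      note [measurable] = meas[OF n] K
      define B where "B = {x\<in>space N. g n x > c}"
      have [measurable]: "B \<in> sets N" unfolding B_def by measurable
      have "ennreal c * emeasure N (B \<inter> K) \<le> (\<integral>\<^sup>+x\<in>B. ennreal (g n x) \<partial>N)"
      proof -
        have "ennreal c * emeasure N (B \<inter> K) = (\<integral>\<^sup>+x. ennreal c * indicator (B \<inter> K) x \<partial>N)"
          by (rule nn_integral_cmult_indicator[symmetric]) auto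
        also have "\<dots> \<le> (\<integral>\<^sup>+x\<in>B. ennreal (g n x) \<partial>N)"
          by (intro nn_integral_mono) (auto split: split_indicator intro!: ennreal_leI simp: B_def)
        finally show ?thesis .
      qed
      also have "\<dots> = emeasure (density N (\<lambda>x. ennreal (g n x))) B"
        by (rule emeasure_density[symmetric]) auto
      also have "\<dots> \<le> 1"
        using order_trans[OF emeasure_space prob[OF n, folded space_density[of N "\<lambda>x. ennreal (g n x)"]]] .
      finally have "ennreal c * emeasure N (B \<inter> K) \<le> 1" .
      then have "emeasure N (B \<inter> K) \<le> ennreal (1 / c)"
      proof -
        assume "ennreal c * emeasure N (B \<inter> K) \<le> 1"
        then have "ennreal (1/c) * (ennreal c * emeasure N (B \<inter> K)) \<le> ennreal (1/c) * 1"
          by (intro mult_left_mono) auto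
        then show ?thesis using c by (simp add: mult.assoc[symmetric] ennreal_mult[symmetric])
      qed
      also have "\<dots> < ennreal d" using c' d(1) by (intro ennreal_lessI)
      finally have "emeasure (density N (\<lambda>x. ennreal (g n x))) (B \<inter> K) \<le> ennreal e"
        using d(2)[OF n] by auto
      also have "emeasure (density N (\<lambda>x. ennreal (g n x))) (B \<inter> K) = (\<integral>\<^sup>+x\<in>B. ennreal (g n x) \<partial>trace_measure N K)"
        by (rule emeasure_density_Int) auto
      also have "\<dots> = (\<integral>\<^sup>+x\<in>{x. g n x > c}. ennreal (g n x) \<partial>trace_measure N K)"
        by (intro nn_integral_cong) (auto simp: B_def split: split_indicator)
      finally show "(\<integral>\<^sup>+x\<in>{x. g n x > c}. ennreal (g n x) \<partial>trace_measure N K) \<le> ennreal e" .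
    qed
  qed
qed

text \<open>De la Vallee Poussin's criterion for a power: where \<open>g n\<close> exceeds
  \<open>c\<close> it is at most \<open>c powr (1 - p)\<close> times its p-th power, and this factor
  vanishes as \<open>c\<close> grows.\<close>

lemma uniformly_integrable_powr:
  assumes K: "K \<in> sets N" and meas: "\<And>n. n \<in> I \<Longrightarrow> g n \<in> borel_measurable N" and p: "1 < p"
    and fin: "(SUP n\<in>I. \<integral>\<^sup>+x\<in>K. ennreal (g n x powr p) \<partial>N) < \<infinity>"
  shows "uniformly_integrable (trace_measure N K) I g"
  unfolding uniformly_integrable_def
proof (rule ennreal_tendsto_0I)
  fix e :: real assume e: "0 < e"
  obtain S where S: "0 \<le> S" "(SUP n\<in>I. \<integral>\<^sup>+x\<in>K. ennreal (g n x powr p) \<partial>N) = ennreal S"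
    using fin by (cases "SUP n\<in>I. \<integral>\<^sup>+x\<in>K. ennreal (g n x powr p) \<partial>N") auto
  have "((\<lambda>c. c powr (1 - p) * S) \<longlongrightarrow> 0) at_top"
    using tendsto_neg_powr[OF _ filterlim_ident, of "1 - p"] p by (auto intro!: tendsto_mult_left_zero)
  then have "\<forall>\<^sub>F c in at_top. c powr (1 - p) * S < e"
    using e by (rule order_tendstoD(2))
  with eventually_gt_at_top[of 0]
  show "\<forall>\<^sub>F c in at_top. (SUP n\<in>I. \<integral>\<^sup>+x\<in>{x. g n x > c}. ennreal (g n x) \<partial>trace_measure N K) \<le> ennreal e"
  proof eventually_elim
    case (elim c)
    show ?case
    proof (rule SUP_least)
      fix n assume n: "n \<in> I"
      note [measurable] = meas[OF n] K
      have le: "y \<le> c powr (1 - p) * y powr p" if "c < y" for y :: real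
      proof -
        have "y = y powr (1 - p) * y powr p"
          using that elim by (simp add: powr_add[symmetric])
        also have "\<dots> \<le> c powr (1 - p) * y powr p"
          using that elim p by (intro mult_right_mono powr_mono2') auto
        finally show ?thesis .
      qed
      have "(\<integral>\<^sup>+x\<in>{x. g n x > c}. ennreal (g n x) \<partial>trace_measure N K)
          \<le> (\<integral>\<^sup>+x. ennreal (c powr (1 - p)) * ennreal (g n x powr p) \<partial>trace_measure N K)"
        by (intro nn_integral_mono)
           (auto split: split_indicator simp: ennreal_mult[symmetric] intro!: ennreal_leI le)
      also have "\<dots> = ennreal (c powr (1 - p)) * (\<integral>\<^sup>+x\<in>K. ennreal (g n x powr p) \<partial>N)"
        by (subst nn_integral_cmult) (auto simp: nn_integral_trace_measure measurable_cong_sets[OF sets_trace_measure refl])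
      also have "\<dots> \<le> ennreal (c powr (1 - p)) * ennreal S"
        unfolding S(2)[symmetric] using n by (intro mult_left_mono SUP_upper) auto
      also have "\<dots> \<le> ennreal e"
        using elim S(1) by (auto simp: ennreal_mult[symmetric] intro!: ennreal_leI)
      finally show "(\<integral>\<^sup>+x\<in>{x. g n x > c}. ennreal (g n x) \<partial>trace_measure N K) \<le> ennreal e" .
    qed
  qed
qed

subsection \<open>Filtrations and maximal inequalities\<close>

locale filtered_prob_space = prob_space M for M :: "'w measure" +
  fixes F :: "nat \<Rightarrow> 'w measure"
  assumes subalg: "\<And>n. subalgebra M (F n)"
    and filtration_mono: "\<And>m n. m \<le> n \<Longrightarrow> sets (F m) \<subseteq> sets (F n)"
begin

lemma space_F: "space (F n) = space M"
  using subalg[of n] by (simp add: subalgebra_def)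

lemma sets_F: "A \<in> sets (F n) \<Longrightarrow> A \<in> sets M"
  using subalg[of n] by (auto simp: subalgebra_def)

lemma measurable_F_M: "g \<in> measurable (F n) N \<Longrightarrow> g \<in> measurable M N"
  using measurable_from_subalg[OF subalg] .

lemma measurable_F_mono: "m \<le> n \<Longrightarrow> g \<in> measurable (F m) N \<Longrightarrow> g \<in> measurable (F n) N"
  using filtration_mono[of m n] by (auto simp: measurable_def space_F)

lemma F_sigma_finite_subalgebra: "sigma_finite_subalgebra M (F n)"
  by (intro finite_measure_subalgebra_is_sigma_finite finite_measure_subalgebra.intro
      finite_measure_subalgebra_axioms.intro subalg finite_measure_axioms)

lemma nn_cond_exp_set_integral:
  assumes "A \<in> sets (F n)" "Z \<in> borel_measurable M"
  shows "(\<integral>\<^sup>+\<omega>\<in>A. nn_cond_exp M (F n) Z \<omega> \<partial>M) = (\<integral>\<^sup>+\<omega>\<in>A. Z \<omega> \<partial>M)"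
proof -
  have "(\<integral>\<^sup>+\<omega>. indicator A \<omega> * nn_cond_exp M (F n) Z \<omega> \<partial>M) = (\<integral>\<^sup>+\<omega>. indicator A \<omega> * Z \<omega> \<partial>M)"
    using assms by (intro sigma_finite_subalgebra.nn_cond_exp_intg[OF F_sigma_finite_subalgebra]) auto
  then show ?thesis by (simp add: mult.commute)
qed

text \<open>Doob's argument: the event is split by the first index of exceedance, and on each piece
  \<open>Y n\<close> is pushed forward to \<open>Y k\<close>. Phrasing the submartingale property by
  integrals over sets suits extended nonnegative values, and covers both closed martingales and the
  p-th moments of densities.\<close>

lemma submartingale_maximal_inequality:
  assumes meas: "\<And>n. Y n \<in> borel_measurable (F n)"
    and sub: "\<And>n k A. n \<le> k \<Longrightarrow> A \<in> sets (F n) \<Longrightarrow> (\<integral>\<^sup>+\<omega>\<in>A. Y n \<omega> \<partial>M) \<le> (\<integral>\<^sup>+\<omega>\<in>A. Y k \<omega> \<partial>M)"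
    and bound: "\<And>k. (\<integral>\<^sup>+\<omega>. Y k \<omega> \<partial>M) \<le> C"
  shows "c * emeasure M {\<omega>\<in>space M. \<exists>n. c < Y n \<omega>} \<le> C"
proof -
  \<comment> \<open>The event that \<open>n\<close> is the first index at which \<open>c\<close> is
    exceeded. It is decided at stage \<open>n\<close>, so \<open>sub\<close> applies to it.\<close>
  define A where "A n = {\<omega>\<in>space M. c < Y n \<omega> \<and> (\<forall>j<n. Y j \<omega> \<le> c)}" for n
  have AF: "A n \<in> sets (F n)" for n
  proof -
    have *: "{\<omega>\<in>space M. c < Y j \<omega>} \<in> sets (F n)" if "j \<le> n" for j
      using borel_measurable_less[OF borel_measurable_const measurable_F_mono[OF that meas], of c]
      by (simp add: space_F)
    have "A n = {\<omega>\<in>space M. c < Y n \<omega>} - (\<Union>j\<in>{..<n}. {\<omega>\<in>space M. c < Y j \<omega>})"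
      by (auto simp: A_def not_less)
    then show ?thesis using * by auto
  qed
  have AM [measurable]: "A n \<in> sets M" for n using AF sets_F by blast
  have [measurable]: "Y n \<in> borel_measurable M" for n using meas measurable_F_M by blast
  have disj: "disjoint_family A"
    unfolding disjoint_family_on_def A_def by (auto simp: not_le[symmetric]) (metis linorder_neqE_nat not_le)
  have step: "c * emeasure M (\<Union>n\<in>{..k}. A n) \<le> C" for k
  proof -
    have "c * emeasure M (\<Union>n\<in>{..k}. A n) = (\<Sum>n\<le>k. c * emeasure M (A n))"
      using disj by (subst sum_emeasure[symmetric])
        (auto simp: sum_distrib_left disjoint_family_on_def)
    also have "\<dots> \<le> (\<Sum>n\<le>k. \<integral>\<^sup>+\<omega>\<in>A n. Y n \<omega> \<partial>M)"
    proof (rule sum_mono)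
      fix n
      have "c * emeasure M (A n) = (\<integral>\<^sup>+\<omega>. c * indicator (A n) \<omega> \<partial>M)"
        by (rule nn_integral_cmult_indicator[symmetric]) simp
      also have "\<dots> \<le> (\<integral>\<^sup>+\<omega>\<in>A n. Y n \<omega> \<partial>M)"
        by (intro nn_integral_mono) (auto simp: A_def split: split_indicator)
      finally show "c * emeasure M (A n) \<le> (\<integral>\<^sup>+\<omega>\<in>A n. Y n \<omega> \<partial>M)" .
    qed
    also have "\<dots> \<le> (\<Sum>n\<le>k. \<integral>\<^sup>+\<omega>\<in>A n. Y k \<omega> \<partial>M)"
      using AF by (intro sum_mono sub) auto
    also have "\<dots> = (\<integral>\<^sup>+\<omega>. (\<Sum>n\<le>k. Y k \<omega> * indicator (A n) \<omega>) \<partial>M)"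
      by (rule nn_integral_sum[symmetric]) auto
    also have "\<dots> = (\<integral>\<^sup>+\<omega>\<in>(\<Union>n\<in>{..k}. A n). Y k \<omega> \<partial>M)"
      using disj by (intro nn_integral_cong)
        (simp add: sum_distrib_left[symmetric] indicator_UN_disjoint disjoint_family_on_def)
    also have "\<dots> \<le> (\<integral>\<^sup>+\<omega>. Y k \<omega> \<partial>M)"
      by (intro nn_integral_mono) (auto split: split_indicator)
    finally show ?thesis using bound[of k] by (rule order_trans)
  qed
  have "{\<omega>\<in>space M. \<exists>n. c < Y n \<omega>} = (\<Union>n. A n)"
  proof (intro equalityI subsetI)
    fix \<omega> assume "\<omega> \<in> {\<omega>\<in>space M. \<exists>n. c < Y n \<omega>}"
    then have w: "\<omega> \<in> space M" "\<exists>n. c < Y n \<omega>" by auto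
    from exists_least_iff[THEN iffD1, OF w(2)] show "\<omega> \<in> (\<Union>n. A n)"
      using w(1) by (auto simp: A_def not_less)
  qed (auto simp: A_def)
  also have "(\<Union>n. A n) = (\<Union>k. \<Union>n\<in>{..k}. A n)" by auto
  finally have "c * emeasure M {\<omega>\<in>space M. \<exists>n. c < Y n \<omega>} = c * (SUP k. emeasure M (\<Union>n\<in>{..k}. A n))"
  proof (subst SUP_emeasure_incseq)
    show "incseq (\<lambda>k. \<Union>n\<in>{..k}. A n)" unfolding incseq_def by force
  qed auto
  also have "\<dots> = (SUP k. c * emeasure M (\<Union>n\<in>{..k}. A n))"
    by (rule SUP_mult_left_ennreal)
  also have "\<dots> \<le> C" using step by (intro SUP_least)
  finally show ?thesis .
qed

lemma nn_cond_exp_maximal_inequality: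
  assumes [measurable]: "Z \<in> borel_measurable M"
  shows "c * emeasure M {\<omega>\<in>space M. \<exists>n. c < nn_cond_exp M (F n) Z \<omega>} \<le> (\<integral>\<^sup>+\<omega>. Z \<omega> \<partial>M)"
proof (rule submartingale_maximal_inequality)
  fix n k A assume "n \<le> k" "A \<in> sets (F n)"
  then show "(\<integral>\<^sup>+\<omega>\<in>A. nn_cond_exp M (F n) Z \<omega> \<partial>M) \<le> (\<integral>\<^sup>+\<omega>\<in>A. nn_cond_exp M (F k) Z \<omega> \<partial>M)"
    using filtration_mono[of n k] by (subst (1 2) nn_cond_exp_set_integral) auto
next
  fix k
  have "(\<integral>\<^sup>+\<omega>\<in>space M. nn_cond_exp M (F k) Z \<omega> \<partial>M) = (\<integral>\<^sup>+\<omega>\<in>space M. Z \<omega> \<partial>M)"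
    using sets.top[of "F k"] by (intro nn_cond_exp_set_integral) (auto simp: space_F)
  moreover have "(\<integral>\<^sup>+\<omega>\<in>space M. g \<omega> \<partial>M) = (\<integral>\<^sup>+\<omega>. g \<omega> \<partial>M)" for g
    by (intro nn_integral_cong) auto
  ultimately show "(\<integral>\<^sup>+\<omega>. nn_cond_exp M (F k) Z \<omega> \<partial>M) \<le> (\<integral>\<^sup>+\<omega>. Z \<omega> \<partial>M)"
    by simp
qed (rule borel_measurable_nn_cond_exp)

text \<open>Sets approximable in measure by sets of some stage are closed under complements and
  countable unions. For a union, all but finitely many sets are cut off, and the rest are
  approximated within a common stage.\<close>

lemma approximation_by_filtration:
  assumes B: "B \<in> sigma_sets (space M) (\<Union>n. sets (F n))" and "0 < e"
  shows "\<exists>n. \<exists>D\<in>sets (F n). measure M ((B - D) \<union> (D - B)) < e"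
  using assms
proof (induction arbitrary: e rule: sigma_sets.induct)
  case (Basic a)
  then show ?case by (auto intro!: bexI[of _ a])
next
  case Empty
  then show ?case by (auto intro!: bexI[of _ "{}"])
next
  case (Compl a)
  obtain n D where D: "D \<in> sets (F n)" "measure M ((a - D) \<union> (D - a)) < e"
    using Compl.IH[OF Compl.prems] by blast
  have "a \<subseteq> space M"
    using sigma_sets_into_sp[OF _ Compl.hyps] sets.sets_into_space space_F by blast
  then have "((space M - a) - (space M - D)) \<union> ((space M - D) - (space M - a)) = (a - D) \<union> (D - a)"
    using sets.sets_into_space[OF D(1)] by (auto simp: space_F)
  moreover have "space M - D \<in> sets (F n)" using D(1) sets.compl_sets[of D "F n"] by (simp add: space_F)
  ultimately show ?case using D by (intro exI[of _ n] bexI[of _ "space M - D"]) simp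
next
  case (Union a)
  have FM: "(\<Union>n. sets (F n)) \<subseteq> sets M" using sets_F by blast
  have [measurable]: "a i \<in> sets M" for i
    using Union.hyps[of i] sets.sigma_sets_subset[OF FM] by blast
  have "(\<lambda>N. measure M (\<Union>i\<in>{..N}. a i)) \<longlonglongrightarrow> measure M (\<Union>N. \<Union>i\<in>{..N}. a i)"
  proof (rule finite_Lim_measure_incseq)
    show "incseq (\<lambda>N. \<Union>i\<in>{..N}. a i)" unfolding incseq_def by force
  qed auto
  moreover have "(\<Union>N. \<Union>i\<in>{..N}. a i) = (\<Union>i. a i)" by auto
  ultimately have "\<forall>\<^sub>F N in sequentially. measure M (\<Union>i. a i) - e / 2 < measure M (\<Union>i\<in>{..N}. a i)"
    using Union.prems by (intro order_tendstoD(1)[where y="measure M (\<Union>i. a i)"]) auto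
  then obtain N where N: "measure M (\<Union>i. a i) - e / 2 < measure M (\<Union>i\<in>{..N}. a i)"
    by (auto simp: eventually_sequentially)
  \<comment> \<open>Half of \<open>e\<close> pays for cutting the union off at \<open>N\<close>; the
    other half is shared by the \<open>N + 1\<close> sets with index at most
    \<open>N\<close>.\<close>
  let ?e = "e / (2 * (real N + 1))"
  have "0 < ?e" using Union.prems by simp
  then have "\<forall>i. \<exists>n. \<exists>D\<in>sets (F n). measure M ((a i - D) \<union> (D - a i)) < ?e"
    using Union.IH by blast
  then obtain n D where D: "\<And>i. D i \<in> sets (F (n i))" "\<And>i. measure M ((a i - D i) \<union> (D i - a i)) < ?e"
    by metis
  have [measurable]: "D i \<in> sets M" for i using D(1) sets_F by blast
  let ?D = "\<Union>i\<in>{..N}. D i"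
  have "D i \<in> sets (F (Max (n ` {..N})))" if "i \<le> N" for i
    using D(1)[of i] filtration_mono[of "n i" "Max (n ` {..N})"] that by auto
  then have DF: "?D \<in> sets (F (Max (n ` {..N})))" by auto
  have "measure M (((\<Union>i. a i) - ?D) \<union> (?D - (\<Union>i. a i)))
      \<le> measure M (((\<Union>i. a i) - (\<Union>i\<in>{..N}. a i)) \<union> (\<Union>i\<in>{..N}. (a i - D i) \<union> (D i - a i)))"
    by (intro finite_measure_mono) auto
  also have "\<dots> \<le> measure M ((\<Union>i. a i) - (\<Union>i\<in>{..N}. a i)) + measure M (\<Union>i\<in>{..N}. (a i - D i) \<union> (D i - a i))"
    by (intro measure_Un_le) auto
  also have "measure M ((\<Union>i. a i) - (\<Union>i\<in>{..N}. a i)) < e / 2"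
    using N by (subst finite_measure_Diff) auto
  also have "measure M (\<Union>i\<in>{..N}. (a i - D i) \<union> (D i - a i)) \<le> (\<Sum>i\<in>{..N}. measure M ((a i - D i) \<union> (D i - a i)))"
    by (intro finite_measure_subadditive_finite) auto
  also have "\<dots> \<le> (\<Sum>i\<in>{..N}. ?e)"
    using D(2) by (intro sum_mono less_imp_le)
  also have "\<dots> = e / 2" by (simp add: field_simps)
  finally show ?case using DF by (intro exI bexI) auto
qed

lemma sets_sigma_filtration:
  "sets (sigma (space M) (\<Union>n. sets (F n))) = sigma_sets (space M) (\<Union>n. sets (F n))"
  using sets.sets_into_space space_F by (intro sets_measure_of) blast

lemma sigma_filtration_subset: "B \<in> sigma_sets (space M) (\<Union>n. sets (F n)) \<Longrightarrow> B \<in> sets M"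
  using sets.sigma_sets_subset[of "\<Union>n. sets (F n)" M] sets_F by blast

text \<open>The needed half of Levy's upward theorem, without convergence. Consider the event that
  all conditional expectations stay at or below \<open>c\<close> while \<open>Z\<close> exceeds
  \<open>c\<close>. Approximating it at a finite stage shows that \<open>Z\<close> integrates over
  it to at most \<open>c\<close> times its probability, so it is null.\<close>

lemma nn_cond_exp_SUP_ge:
  assumes Z: "Z \<in> borel_measurable (sigma (space M) (\<Union>n. sets (F n)))" and le1: "\<And>\<omega>. \<omega> \<in> space M \<Longrightarrow> Z \<omega> \<le> 1"
  shows "AE \<omega> in M. Z \<omega> \<le> (SUP n. nn_cond_exp M (F n) Z \<omega>)"
proof -
  let ?S = "sigma (space M) (\<Union>n. sets (F n))"
  let ?Z = "\<lambda>n. nn_cond_exp M (F n) Z"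
  have sub: "subalgebra M ?S"
    unfolding subalgebra_def using sigma_filtration_subset by (auto simp: sets_sigma_filtration space_measure_of_conv)
  have ZM [measurable]: "Z \<in> borel_measurable M"
    by (rule measurable_from_subalg[OF sub Z])
  have sp: "space ?S = space M" by (simp add: space_measure_of_conv)
  have FS: "g \<in> borel_measurable (F n) \<Longrightarrow> g \<in> borel_measurable ?S" for g :: "'w \<Rightarrow> ennreal" and n
    by (auto simp: measurable_def space_F sp sets_sigma_filtration intro: sigma_sets.Basic)
  have "AE \<omega> in M. \<not> ((\<forall>n. ?Z n \<omega> \<le> ennreal c) \<and> ennreal c < Z \<omega>)" for c
  proof -
    define B where "B = {\<omega>\<in>space M. (\<forall>n. ?Z n \<omega> \<le> ennreal c) \<and> ennreal c < Z \<omega>}"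
    have "{\<omega>\<in>space ?S. (\<forall>n. ?Z n \<omega> \<le> ennreal c) \<and> ennreal c < Z \<omega>} \<in> sets ?S"
      using FS[OF borel_measurable_nn_cond_exp] Z by measurable
    then have BS: "B \<in> sigma_sets (space M) (\<Union>n. sets (F n))"
      by (simp add: B_def sp sets_sigma_filtration)
    then have [measurable]: "B \<in> sets M" by (rule sigma_filtration_subset)
    have eps: "(\<integral>\<^sup>+\<omega>\<in>B. Z \<omega> \<partial>M) \<le> ennreal c * emeasure M B + ennreal e" if "0 < e" for e :: real
    proof -
      \<comment> \<open>The errors \<open>ennreal c * ennreal e'\<close> from \<open>D - B\<close>
        and \<open>ennreal e'\<close> from \<open>B - D\<close> add up to at most \<open>e\<close>.
        The maximum with 0 covers negative \<open>c\<close>, for which \<open>ennreal c\<close> is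
        0.\<close>
      define e' where "e' = e / (max c 0 + 1)"
      have e': "0 < e'" using that by (simp add: e'_def)
      obtain n D where D: "D \<in> sets (F n)" "measure M ((B - D) \<union> (D - B)) < e'"
        using approximation_by_filtration[OF BS e'] by blast
      have [measurable]: "D \<in> sets M" using D(1) by (rule sets_F)
      have small: "emeasure M (B - D) \<le> ennreal e'" "emeasure M (D - B) \<le> ennreal e'"
        using D(2) finite_measure_mono[of "B - D" "(B - D) \<union> (D - B)"]
          finite_measure_mono[of "D - B" "(B - D) \<union> (D - B)"]
        by (auto simp: emeasure_eq_measure intro!: ennreal_leI)
      \<comment> \<open>Of the conditions defining \<open>B\<close> only the one at stage
        \<open>n\<close> is kept. Then \<open>A \<inter> D\<close> belongs to stage
        \<open>n\<close>, so \<open>Z\<close> may be exchanged there with its conditional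
        expectation, and of \<open>B\<close> it misses only \<open>B - D\<close>, where
        \<open>Z\<close> is at most 1.\<close>
      define A where "A = {\<omega>\<in>space (F n). ?Z n \<omega> \<le> ennreal c}"
      have AF: "A \<in> sets (F n)" unfolding A_def by measurable
      have [measurable]: "A \<in> sets M" using AF by (rule sets_F)
      have "(\<integral>\<^sup>+\<omega>\<in>B. Z \<omega> \<partial>M) \<le> (\<integral>\<^sup>+\<omega>. Z \<omega> * indicator (A \<inter> D) \<omega> + indicator (B - D) \<omega> \<partial>M)"
        using le1 by (intro nn_integral_mono) (auto simp: A_def B_def space_F split: split_indicator)
      also have "\<dots> = (\<integral>\<^sup>+\<omega>\<in>A \<inter> D. Z \<omega> \<partial>M) + emeasure M (B - D)"
        by (subst nn_integral_add) auto
      also have "(\<integral>\<^sup>+\<omega>\<in>A \<inter> D. Z \<omega> \<partial>M) = (\<integral>\<^sup>+\<omega>\<in>A \<inter> D. ?Z n \<omega> \<partial>M)"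
        using AF D(1) by (intro nn_cond_exp_set_integral[symmetric]) auto
      also have "\<dots> \<le> (\<integral>\<^sup>+\<omega>. ennreal c * indicator (B \<union> (D - B)) \<omega> \<partial>M)"
        by (intro nn_integral_mono) (auto simp: A_def split: split_indicator)
      also have "\<dots> = ennreal c * emeasure M (B \<union> (D - B))"
        by (rule nn_integral_cmult_indicator) auto
      also have "\<dots> \<le> ennreal c * (emeasure M B + ennreal e')"
        using small(2) by (intro mult_left_mono order_trans[OF emeasure_subadditive] add_left_mono) auto
      also have "ennreal c * (emeasure M B + ennreal e') + emeasure M (B - D)
          \<le> ennreal c * (emeasure M B + ennreal e') + ennreal e'"
        using small(1) by (intro add_left_mono)
      also have "\<dots> = ennreal c * emeasure M B + (ennreal c * ennreal e' + ennreal e')"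
        by (simp add: distrib_left add.assoc)
      also have "ennreal c * ennreal e' + ennreal e' \<le> ennreal (max c 0 * e' + e')"
        using e' by (auto simp: ennreal_mult' max_def ennreal_neg)
      also have "max c 0 * e' + e' = (max c 0 + 1) * e'"
        by (simp add: algebra_simps)
      also have "\<dots> = e"
        unfolding e'_def by (simp add: max_def)
      finally show ?thesis by (auto intro: add_left_mono)
    qed
    have le: "(\<integral>\<^sup>+\<omega>\<in>B. Z \<omega> \<partial>M) \<le> ennreal c * emeasure M B"
      by (rule ennreal_le_epsilon) (rule eps)
    have "(\<integral>\<^sup>+\<omega>\<in>B. Z \<omega> \<partial>M) = (\<integral>\<^sup>+\<omega>. (Z \<omega> - ennreal c) * indicator B \<omega> + ennreal c * indicator B \<omega> \<partial>M)"
    proof (rule nn_integral_cong)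
      fix \<omega>
      show "Z \<omega> * indicator B \<omega> = (Z \<omega> - ennreal c) * indicator B \<omega> + ennreal c * indicator B \<omega>"
        using diff_add_cancel_ennreal[of "ennreal c" "Z \<omega>"] by (cases "\<omega> \<in> B") (auto simp: B_def)
    qed
    also have "\<dots> = (\<integral>\<^sup>+\<omega>\<in>B. (Z \<omega> - ennreal c) \<partial>M) + ennreal c * emeasure M B"
      by (subst nn_integral_add) (auto simp: nn_integral_cmult_indicator)
    finally have "ennreal c * emeasure M B + (\<integral>\<^sup>+\<omega>\<in>B. (Z \<omega> - ennreal c) \<partial>M) \<le> ennreal c * emeasure M B + 0"
      using le by (simp add: add.commute)
    \<comment> \<open>Being finite, this term can be cancelled: the excess of \<open>Z\<close> over
      \<open>c\<close> on \<open>B\<close> integrates to 0 although it is positive there.\<close>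
    moreover have "ennreal c * emeasure M B \<noteq> \<infinity>"
      by (simp add: ennreal_mult_eq_top_iff emeasure_eq_measure)
    ultimately have "(\<integral>\<^sup>+\<omega>\<in>B. (Z \<omega> - ennreal c) \<partial>M) = 0"
      unfolding ennreal_add_left_cancel_le by simp
    then have "AE \<omega> in M. (Z \<omega> - ennreal c) * indicator B \<omega> = 0"
      by (subst (asm) nn_integral_0_iff_AE) auto
    then show ?thesis
      by (rule AE_mp) (auto simp: B_def dest!: ennreal_minus_eq_0 intro!: AE_I2 split: split_indicator_asm)
  qed
  \<comment> \<open>If the claim fails, a rational lies in the gap, so countably many levels
    suffice.\<close>
  then have "AE \<omega> in M. \<forall>q::rat. \<not> ((\<forall>n. ?Z n \<omega> \<le> ennreal (of_rat q)) \<and> ennreal (of_rat q) < Z \<omega>)"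
    by (subst AE_all_countable) auto
  then show ?thesis
  proof eventually_elim
    case (elim \<omega>)
    show ?case
    proof (rule ccontr)
      assume "\<not> Z \<omega> \<le> (SUP n. ?Z n \<omega>)"
      then obtain q :: rat where "(SUP n. ?Z n \<omega>) < ennreal (of_rat q)" "ennreal (of_rat q) < Z \<omega>"
        using ennreal_rat_dense[of "SUP n. ?Z n \<omega>" "Z \<omega>"] by (auto simp: not_le)
      moreover from this have "?Z n \<omega> \<le> ennreal (of_rat q)" for n
        using SUP_upper[of n UNIV "\<lambda>n. ?Z n \<omega>"] by (meson UNIV_I less_imp_le order_trans)
      ultimately show False using elim by blast
    qed
  qed
qed

end

subsection \<open>Measure-valued martingales\<close>

text \<open>The kernels \<open>\<alpha>s n\<close> are required to be measurable for
  \<open>M\<close> only and to agree almost surely with conditional expectations: a modification on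
  a null set may destroy adaptedness.\<close>

locale measure_martingale = filtered_prob_space M F for M :: "'w measure" and F :: "nat \<Rightarrow> 'w measure" +
  fixes \<alpha> :: "'w \<Rightarrow> 'a::polish_space measure" and \<alpha>s :: "nat \<Rightarrow> 'w \<Rightarrow> 'a measure"
  assumes kernel: "\<alpha> \<in> M \<rightarrow>\<^sub>M prob_algebra borel"
    and kernels: "\<And>n. \<alpha>s n \<in> M \<rightarrow>\<^sub>M prob_algebra borel"
    and kernels_cond_exp: "\<And>n C. C \<in> sets borel \<Longrightarrow>
      AE \<omega> in M. emeasure (\<alpha>s n \<omega>) C = nn_cond_exp M (F n) (\<lambda>\<omega>. emeasure (\<alpha> \<omega>) C) \<omega>"
begin

lemma sets_kernel: "\<omega> \<in> space M \<Longrightarrow> sets (\<alpha> \<omega>) = sets borel" "\<omega> \<in> space M \<Longrightarrow> sets (\<alpha>s n \<omega>) = sets borel"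
  using measurable_space[OF kernel] measurable_space[OF kernels] by (auto simp: space_prob_algebra)

lemma prob_kernel: "\<omega> \<in> space M \<Longrightarrow> prob_space (\<alpha> \<omega>)" "\<omega> \<in> space M \<Longrightarrow> prob_space (\<alpha>s n \<omega>)"
  using measurable_space[OF kernel] measurable_space[OF kernels] by (auto simp: space_prob_algebra)

lemma emeasure_kernel_le_1: "\<omega> \<in> space M \<Longrightarrow> emeasure (\<alpha> \<omega>) C \<le> 1"
  by (simp add: prob_kernel(1) prob_space.emeasure_le_1)

lemma borel_measurable_emeasure_kernel [measurable]:
  assumes "C \<in> sets borel"
  shows "(\<lambda>\<omega>. emeasure (\<alpha> \<omega>) C) \<in> borel_measurable M" "(\<lambda>\<omega>. emeasure (\<alpha>s n \<omega>) C) \<in> borel_measurable M"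
  using measurable_compose[OF measurable_prob_algebraD[OF kernel] measurable_emeasure_subprob_algebra[OF assms]]
    measurable_compose[OF measurable_prob_algebraD[OF kernels] measurable_emeasure_subprob_algebra[OF assms]]
  by auto

lemma AE_kernels_le_cond_exp:
  assumes C: "C \<in> sets borel" and Z: "Z \<in> borel_measurable M"
    and le: "\<And>\<omega>. \<omega> \<in> space M \<Longrightarrow> emeasure (\<alpha> \<omega>) C \<le> Z \<omega>"
  shows "AE \<omega> in M. emeasure (\<alpha>s n \<omega>) C \<le> nn_cond_exp M (F n) Z \<omega>"
proof -
  have "AE \<omega> in M. nn_cond_exp M (F n) (\<lambda>\<omega>. emeasure (\<alpha> \<omega>) C) \<omega> \<le> nn_cond_exp M (F n) Z \<omega>"
    by (intro sigma_finite_subalgebra.nn_cond_exp_mono[OF F_sigma_finite_subalgebra] AE_I2 le Z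
        borel_measurable_emeasure_kernel C)
  with kernels_cond_exp[OF C, of n] show ?thesis by eventually_elim simp
qed

lemma emeasure_trace_kernel:
  assumes "\<omega> \<in> space M" "K \<in> sets borel" "B \<in> sets borel"
  shows "emeasure (trace_measure (\<alpha> \<omega>) K) B = emeasure (\<alpha> \<omega>) (B \<inter> K)"
    "emeasure (trace_measure (\<alpha>s n \<omega>) K) B = emeasure (\<alpha>s n \<omega>) (B \<inter> K)"
  using assms by (auto intro!: emeasure_trace_measure simp: sets_kernel)

lemma AE_kernels_equi_absolutely_continuous:
  assumes sets_lam: "sets lam = sets borel" and K: "K \<in> sets borel" "emeasure lam K < \<infinity>"
    and ac: "AE \<omega> in M. absolutely_continuous lam (\<alpha> \<omega>)"
  shows "AE \<omega> in M. \<forall>e::real>0. \<exists>d::real>0. \<forall>n. \<forall>B\<in>sets borel.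
    emeasure lam (B \<inter> K) < ennreal d \<longrightarrow> emeasure (\<alpha>s n \<omega>) (B \<inter> K) \<le> ennreal e"
proof -
  obtain \<V> :: "'a set set" where \<V>: "countable \<V>" "\<And>V. V \<in> \<V> \<Longrightarrow> open V"
    "\<And>U. open U \<Longrightarrow> \<exists>W::nat \<Rightarrow> 'a set. range W \<subseteq> \<V> \<and> incseq W \<and> U = \<Union>(range W)"
    using open_union_of_countable_family by blast
  \<comment> \<open>Smallness is measured by \<open>lam\<close>, so the family does not depend on
    \<omega>. Together with countability this makes the supremum \<open>Z j\<close> a random
    variable.\<close>
  define \<W> where "\<W> j = {V \<in> \<V>. emeasure lam (V \<inter> K) < ennreal ((1/2)^j)}" for j :: nat
  have W: "countable (\<W> j)" "\<And>V. V \<in> \<W> j \<Longrightarrow> V \<inter> K \<in> sets borel" for j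
    using \<V>(1,2) K(1) by (auto simp: \<W>_def intro: countable_subset[OF _ \<V>(1)])
  define Z where "Z j \<omega> = (SUP V\<in>\<W> j. emeasure (\<alpha> \<omega>) (V \<inter> K))" for j \<omega>
  have Zm [measurable]: "Z j \<in> borel_measurable M" for j
    unfolding Z_def using W by (intro borel_measurable_SUP borel_measurable_emeasure_kernel) auto
  have lamK: "emeasure (trace_measure lam K) B = emeasure lam (B \<inter> K)" if "B \<in> sets borel" for B
    using that K sets_lam by (intro emeasure_trace_measure) auto
  have fin: "emeasure (trace_measure lam K) UNIV \<noteq> \<infinity>"
    using K(2) lamK[of UNIV] by simp
  have sp: "space lam = UNIV" using sets_eq_imp_space_eq[OF sets_lam] by simp
  have Z0: "AE \<omega> in M. (\<lambda>j. Z j \<omega>) \<longlonglongrightarrow> 0"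
    using ac AE_space
  proof eventually_elim
    case (elim \<omega>)
    have s: "sets (\<alpha> \<omega>) = sets lam" using sets_kernel(1)[OF elim(2)] sets_lam by simp
    have f1: "finite_measure (trace_measure lam K)" using fin sp by (intro finite_measureI) simp
    have f2: "finite_measure (trace_measure (\<alpha> \<omega>) K)"
    proof (rule finite_measureI)
      have "emeasure (trace_measure (\<alpha> \<omega>) K) UNIV \<le> 1"
        using emeasure_kernel_le_1[OF elim(2)] emeasure_trace_kernel(1)[OF elim(2) K(1)] by simp
      then show "emeasure (trace_measure (\<alpha> \<omega>) K) (space (trace_measure (\<alpha> \<omega>) K)) \<noteq> \<infinity>"
        using sp sets_eq_imp_space_eq[OF s] by (auto simp: top_unique)
    qed
    have ac': "absolutely_continuous (trace_measure lam K) (trace_measure (\<alpha> \<omega>) K)"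
      unfolding absolutely_continuous_def
    proof
      fix B assume "B \<in> null_sets (trace_measure lam K)"
      then have B: "B \<in> sets borel" "emeasure lam (B \<inter> K) = 0"
        using lamK[of B] sets_lam by (auto simp: null_sets_def)
      then have "B \<inter> K \<in> null_sets lam" using K(1) sets_lam by (auto simp: null_sets_def)
      then have "emeasure (\<alpha> \<omega>) (B \<inter> K) = 0" using elim(1) by (auto simp: absolutely_continuous_def)
      then show "B \<in> null_sets (trace_measure (\<alpha> \<omega>) K)"
        using B(1) s sets_lam by (auto simp: null_sets_def emeasure_trace_kernel(1)[OF elim(2) K(1)])
    qed
    show ?case
    proof (rule order_tendstoI)
      fix a :: ennreal assume "0 < a"
      then obtain e where e: "0 < e" "e < a" using dense by blast
      \<comment> \<open>This \<open>k\<close> depends on \<omega>. The supremum over the whole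
        family turns the pointwise epsilon-delta property into convergence of random variables, to
        which dominated convergence applies.\<close>
      obtain k :: nat where k: "\<And>B. B \<in> sets (trace_measure lam K) \<Longrightarrow>
          emeasure (trace_measure lam K) B < ennreal ((1/2) ^ k) \<Longrightarrow> emeasure (trace_measure (\<alpha> \<omega>) K) B \<le> e"
        using absolutely_continuous_epsilon_delta[OF f1 f2 _ ac' e(1)] s by (auto simp del: power_divide)
      have "Z j \<omega> \<le> e" if "k \<le> j" for j
        unfolding Z_def
      proof (rule SUP_least)
        fix V assume V: "V \<in> \<W> j"
        then have Vb: "V \<in> sets borel" using \<V>(2) by (auto simp: \<W>_def)
        have "emeasure lam (V \<inter> K) < ennreal ((1/2)^j)" using V by (simp add: \<W>_def)
        also have "\<dots> \<le> ennreal ((1/2)^k)" using that by (intro ennreal_leI power_decreasing) auto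
        finally show "emeasure (\<alpha> \<omega>) (V \<inter> K) \<le> e"
          using k[of V] Vb lamK[OF Vb] emeasure_trace_kernel(1)[OF elim(2) K(1) Vb] sets_lam by simp
      qed
      then show "\<forall>\<^sub>F j in sequentially. Z j \<omega> < a"
        using e(2) by (auto simp: eventually_sequentially intro!: exI[of _ k] intro: le_less_trans)
    qed simp
  qed
  have Z_le_1: "Z j \<omega> \<le> 1" if "\<omega> \<in> space M" for j \<omega>
    unfolding Z_def by (intro SUP_least emeasure_kernel_le_1 that)
  have "(\<lambda>j. \<integral>\<^sup>+\<omega>. Z j \<omega> \<partial>M) \<longlonglongrightarrow> (\<integral>\<^sup>+\<omega>. 0 \<partial>M)"
    by (rule nn_integral_dominated_convergence[where w="\<lambda>_. 1"])
      (use Z0 Z_le_1 in \<open>auto simp: emeasure_space_1\<close>)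
  then have int0: "(\<lambda>j. \<integral>\<^sup>+\<omega>. Z j \<omega> \<partial>M) \<longlonglongrightarrow> 0" by simp
  have "AE \<omega> in M. \<exists>j. \<forall>n. nn_cond_exp M (F n) (Z j) \<omega> \<le> ennreal (1 / Suc i)" for i :: nat
  proof -
    \<comment> \<open>The event that no \<open>j\<close> works for the level
      \<open>1 / Suc i\<close>. By the maximal inequality its probability is at most
      \<open>Suc i\<close> times the mean of \<open>Z j\<close>, for every \<open>j\<close>, and
      these means tend to 0.\<close>
    define N where "N = {\<omega>\<in>space M. \<forall>j. \<exists>n. ennreal (1 / Suc i) < nn_cond_exp M (F n) (Z j) \<omega>}"
    have Nm: "N \<in> sets M" unfolding N_def by measurable
    have "ennreal (1 / Suc i) * emeasure M N \<le> (\<integral>\<^sup>+\<omega>. Z j \<omega> \<partial>M)" for j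
    proof -
      have "{\<omega>\<in>space M. \<exists>n. ennreal (1 / Suc i) < nn_cond_exp M (F n) (Z j) \<omega>} \<in> sets M"
        by measurable
      then have "emeasure M N \<le> emeasure M {\<omega>\<in>space M. \<exists>n. ennreal (1 / Suc i) < nn_cond_exp M (F n) (Z j) \<omega>}"
        by (intro emeasure_mono) (auto simp: N_def)
      then show ?thesis
        by (rule order_trans[OF mult_left_mono nn_cond_exp_maximal_inequality[OF Zm]]) simp
    qed
    then have "ennreal (1 / Suc i) * emeasure M N \<le> 0"
      by (intro LIMSEQ_le_const[OF int0]) auto
    then have "emeasure M N = 0" by simp
    then have "N \<in> null_sets M" using Nm by auto
    then show ?thesis by (intro AE_I[where N=N]) (auto simp: N_def not_le)
  qed
  then have small: "AE \<omega> in M. \<forall>i::nat. \<exists>j. \<forall>n. nn_cond_exp M (F n) (Z j) \<omega> \<le> ennreal (1 / Suc i)"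
    by (subst AE_all_countable) simp
  have "AE \<omega> in M. emeasure (\<alpha>s n \<omega>) (V \<inter> K) \<le> nn_cond_exp M (F n) (Z j) \<omega>" if "V \<in> \<W> j" for n j V
    using that W(2)[OF that] by (intro AE_kernels_le_cond_exp Zm) (auto simp: Z_def intro: SUP_upper)
  then have "AE \<omega> in M. \<forall>n j. \<forall>V\<in>\<W> j. emeasure (\<alpha>s n \<omega>) (V \<inter> K) \<le> nn_cond_exp M (F n) (Z j) \<omega>"
    using W(1) by (simp add: AE_all_countable AE_ball_countable)
  with small AE_space show ?thesis
  proof eventually_elim
    case (elim \<omega>)
    show ?case
    proof (intro allI impI)
      fix e :: real assume "0 < e"
      then obtain i where i: "1 / Suc i < e" using reals_Archimedean[of e] by (auto simp: inverse_eq_divide)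
      obtain j where j: "\<And>n. nn_cond_exp M (F n) (Z j) \<omega> \<le> ennreal (1 / Suc i)"
        using elim(1) by blast
      show "\<exists>d::real>0. \<forall>n. \<forall>B\<in>sets borel.
          emeasure lam (B \<inter> K) < ennreal d \<longrightarrow> emeasure (\<alpha>s n \<omega>) (B \<inter> K) \<le> ennreal e"
      \<comment> \<open>The threshold that defines \<open>\<W> j\<close>: the members of
        \<open>\<V>\<close> below it are exactly those controlled by \<open>Z j\<close>.\<close>
      proof (intro exI[of _ "(1/2)^j"] conjI allI ballI impI)
        fix n B assume B: "B \<in> sets borel" "emeasure lam (B \<inter> K) < ennreal ((1/2)^j)"
        have "emeasure (trace_measure (\<alpha>s n \<omega>) K) B \<le> ennreal e"
        proof (rule emeasure_bound_borel_from_countable[OF _ _ fin \<V>(2,3) _ B(1)])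
          show "emeasure (trace_measure lam K) B < ennreal ((1/2)^j)" using B lamK by simp
          fix V assume V: "V \<in> \<V>" "emeasure (trace_measure lam K) V < ennreal ((1/2)^j)"
          have Vb: "V \<in> sets borel" using V \<V>(2) by auto
          have "V \<in> \<W> j" using V lamK[OF Vb] by (simp add: \<W>_def)
          then have "emeasure (\<alpha>s n \<omega>) (V \<inter> K) \<le> nn_cond_exp M (F n) (Z j) \<omega>" using elim(3) by blast
          also have "\<dots> \<le> ennreal (1 / Suc i)" by (rule j)
          also have "\<dots> \<le> ennreal e" using i by (intro ennreal_leI) simp
          finally show "emeasure (trace_measure (\<alpha>s n \<omega>) K) V \<le> ennreal e"
            using emeasure_trace_kernel(2)[OF elim(2) K(1) Vb] by simp
        qed (auto simp: sets_lam sets_kernel elim(2))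
        then show "emeasure (\<alpha>s n \<omega>) (B \<inter> K) \<le> ennreal e"
          using emeasure_trace_kernel(2)[OF elim(2) K(1) B(1)] by simp
      qed simp
    qed
  qed
qed

text \<open>Weak convergence yields such a bound on open sets, but it is needed on their
  intersections with compact sets. Measurability in the limit sigma-field gives it for each Borel
  set, at the price of a null set depending on \<open>C\<close>.\<close>

lemma AE_kernel_le_SUP:
  assumes \<alpha>: "\<alpha> \<in> sigma (space M) (\<Union>n. sets (F n)) \<rightarrow>\<^sub>M prob_algebra borel" and C: "C \<in> sets borel"
  shows "AE \<omega> in M. emeasure (\<alpha> \<omega>) C \<le> (SUP n. emeasure (\<alpha>s n \<omega>) C)"
proof -
  have "AE \<omega> in M. emeasure (\<alpha> \<omega>) C \<le> (SUP n. nn_cond_exp M (F n) (\<lambda>\<omega>. emeasure (\<alpha> \<omega>) C) \<omega>)"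
    by (intro nn_cond_exp_SUP_ge emeasure_kernel_le_1
        measurable_compose[OF measurable_prob_algebraD[OF \<alpha>] measurable_emeasure_subprob_algebra[OF C]])
  moreover have "AE \<omega> in M. \<forall>n. emeasure (\<alpha>s n \<omega>) C = nn_cond_exp M (F n) (\<lambda>\<omega>. emeasure (\<alpha> \<omega>) C) \<omega>"
    using kernels_cond_exp[OF C] by (simp add: AE_all_countable)
  ultimately show ?thesis by eventually_elim simp
qed

lemma AE_kernel_absolutely_continuous:
  assumes \<alpha>: "\<alpha> \<in> sigma (space M) (\<Union>n. sets (F n)) \<rightarrow>\<^sub>M prob_algebra borel"
    and sets_lam: "sets lam = sets borel" and sf: "sigma_finite_measure lam"
    and ac: "AE \<omega> in M. \<forall>n. absolutely_continuous lam (\<alpha>s n \<omega>)"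
    and eac: "\<And>K. compact K \<Longrightarrow> emeasure lam K < \<infinity> \<Longrightarrow>
      AE \<omega> in M. \<forall>e::real>0. \<exists>d::real>0. \<forall>n. \<forall>B\<in>sets borel.
        emeasure lam (B \<inter> K) < ennreal d \<longrightarrow> emeasure (\<alpha>s n \<omega>) (B \<inter> K) \<le> ennreal e"
  shows "AE \<omega> in M. absolutely_continuous lam (\<alpha> \<omega>)"
proof -
  obtain \<V> :: "'a set set" where \<V>: "countable \<V>" "\<And>V. V \<in> \<V> \<Longrightarrow> open V"
    "\<And>U. open U \<Longrightarrow> \<exists>W::nat \<Rightarrow> 'a set. range W \<subseteq> \<V> \<and> incseq W \<and> U = \<Union>(range W)"
    using open_union_of_countable_family by blast
  obtain \<C> :: "'a set set" where \<C>: "countable \<C>" "\<And>K. K \<in> \<C> \<Longrightarrow> compact K"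
    "\<And>K. K \<in> \<C> \<Longrightarrow> emeasure lam K < \<infinity>" "emeasure lam (- \<Union>\<C>) = 0"
    using sigma_finite_exhausted_by_compacts[OF sets_lam sf] by blast
  have Cb: "K \<in> sets borel" if "K \<in> \<C>" for K using \<C>(2)[OF that] by (rule borel_compact)
  have Vb: "V \<in> sets borel" if "V \<in> \<V>" for V using \<V>(2)[OF that] by (rule borel_open)
  have restb: "- \<Union>\<C> \<in> sets borel"
    using Cb \<C>(1) by (intro borel_comp sets.countable_Union) auto
  have 1: "AE \<omega> in M. \<forall>K\<in>\<C>. \<forall>V\<in>\<V>. emeasure (\<alpha> \<omega>) (V \<inter> K) \<le> (SUP n. emeasure (\<alpha>s n \<omega>) (V \<inter> K))"
    using \<V>(1) \<C>(1) Cb Vb by (simp add: AE_ball_countable AE_kernel_le_SUP[OF \<alpha>])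
  have 2: "AE \<omega> in M. \<forall>K\<in>\<C>. \<forall>e::real>0. \<exists>d::real>0. \<forall>n. \<forall>B\<in>sets borel.
        emeasure lam (B \<inter> K) < ennreal d \<longrightarrow> emeasure (\<alpha>s n \<omega>) (B \<inter> K) \<le> ennreal e"
    using \<C> by (subst AE_ball_countable) (auto intro: eac)
  show ?thesis
    using 1 2 ac AE_kernel_le_SUP[OF \<alpha> restb] AE_space
  proof eventually_elim
    case (elim \<omega>)
    note s = sets_kernel(1)[OF elim(5)]
    \<comment> \<open>The part not covered by the compact sets is \<open>lam\<close>-null, hence
      null for every \<open>\<alpha>s n \<omega>\<close>. The supremum bound transfers this to
      \<open>\<alpha> \<omega>\<close>, so no mass escapes the compact sets.\<close>
    have "emeasure (\<alpha>s n \<omega>) (- \<Union>\<C>) = 0" for n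
      using elim(3) \<C>(4) restb sets_lam unfolding absolutely_continuous_def null_sets_def by blast
    then have rest: "- \<Union>\<C> \<in> null_sets (\<alpha> \<omega>)"
      using elim(4) restb s by (auto simp: null_sets_def)
    show ?case
      unfolding absolutely_continuous_def
    proof
      fix B assume "B \<in> null_sets lam"
      then have B: "B \<in> sets borel" "emeasure lam B = 0" using sets_lam by (auto simp: null_sets_def)
      have BK: "B \<inter> K \<in> null_sets (\<alpha> \<omega>)" if K: "K \<in> \<C>" for K
      proof -
        have lamK: "emeasure (trace_measure lam K) A = emeasure lam (A \<inter> K)" if "A \<in> sets borel" for A
          using that Cb[OF K] sets_lam by (intro emeasure_trace_measure) auto
        have BK0: "emeasure lam (B \<inter> K) = 0"
          using emeasure_mono[of "B \<inter> K" B lam] B sets_lam by auto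
        have eps: "emeasure (\<alpha> \<omega>) (B \<inter> K) \<le> 0 + ennreal e" if e: "0 < e" for e :: real
        proof -
          obtain d :: real where d: "0 < d" "\<And>n B. B \<in> sets borel \<Longrightarrow> emeasure lam (B \<inter> K) < ennreal d \<Longrightarrow>
              emeasure (\<alpha>s n \<omega>) (B \<inter> K) \<le> ennreal e"
            using elim(2)[rule_format, OF K e] by blast
          have "emeasure (trace_measure (\<alpha> \<omega>) K) B \<le> ennreal e"
          \<comment> \<open>On members of the countable family the supremum inherits the bound
            common to all \<open>\<alpha>s n \<omega>\<close>. Regularity extends it to
            \<open>B\<close>, whose part in \<open>K\<close> is \<open>lam\<close>-null and so below
            any threshold.\<close>
          proof (rule emeasure_bound_borel_from_countable[OF _ _ _ \<V>(2,3) _ B(1)])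
            show "emeasure (trace_measure lam K) UNIV \<noteq> \<infinity>" using lamK[of UNIV] \<C>(3)[OF K] by simp
            show "emeasure (trace_measure lam K) B < ennreal d" using lamK[OF B(1)] BK0 d(1) by simp
            fix V assume V: "V \<in> \<V>" "emeasure (trace_measure lam K) V < ennreal d"
            have "emeasure (\<alpha> \<omega>) (V \<inter> K) \<le> (SUP n. emeasure (\<alpha>s n \<omega>) (V \<inter> K))"
              using elim(1) K V(1) by blast
            also have "\<dots> \<le> ennreal e"
              using V(2) lamK[OF Vb[OF V(1)]] by (intro SUP_least d(2) Vb V(1)) simp
            finally show "emeasure (trace_measure (\<alpha> \<omega>) K) V \<le> ennreal e"
              using emeasure_trace_kernel(1)[OF elim(5) Cb[OF K] Vb[OF V(1)]] by simp
          qed (auto simp: sets_lam s)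
          then show ?thesis using emeasure_trace_kernel(1)[OF elim(5) Cb[OF K] B(1)] by simp
        qed
        have "emeasure (\<alpha> \<omega>) (B \<inter> K) \<le> 0"
          by (rule ennreal_le_epsilon) (rule eps)
        then show ?thesis using B(1) Cb[OF K] s by (auto simp: null_sets_def)
      qed
      have "- \<Union>\<C> \<union> (\<Union>K\<in>\<C>. B \<inter> K) \<in> null_sets (\<alpha> \<omega>)"
        by (intro null_sets.Un rest null_sets_UN' BK \<C>(1))
      moreover have "B \<subseteq> - \<Union>\<C> \<union> (\<Union>K\<in>\<C>. B \<inter> K)" by blast
      ultimately show "B \<in> null_sets (\<alpha> \<omega>)"
        using B(1) s by (auto intro: null_sets_subset)
    qed
  qed
qed

end

subsection \<open>Moments of the densities\<close>

text \<open>The graph of the p-th power lies above its tangent at \<open>u\<close>, rearranged so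
  that all terms are nonnegative and can be integrated in \<open>ennreal\<close>. It is Young's
  inequality with weights \<open>1/p\<close> and \<open>(p - 1)/p\<close>.\<close>

lemma powr_tangent_inequality:
  fixes b u p :: real
  assumes p: "1 < p" and "0 \<le> b" "0 \<le> u"
  shows "p * u powr (p - 1) * b \<le> b powr p + (p - 1) * u powr p"
proof (cases "b = 0 \<or> u = 0")
  case True
  then show ?thesis using p by auto
next
  case False
  then have pos: "0 < b" "0 < u" using assms by auto
  have "(b powr p) powr (1/p) * (u powr p) powr ((p - 1)/p) \<le> (1/p) * b powr p + ((p - 1)/p) * u powr p"
    using p pos by (intro Youngs_inequality_0) (auto simp: field_simps)
  then have "b * u powr (p - 1) \<le> (1/p) * b powr p + ((p - 1)/p) * u powr p"
    using p pos by (simp add: powr_powr)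
  then have "p * (b * u powr (p - 1)) \<le> p * ((1/p) * b powr p + ((p - 1)/p) * u powr p)"
    using p by (intro mult_left_mono) auto
  also have "\<dots> = b powr p + (p - 1) * u powr p"
    using p by (simp add: distrib_left)
  finally show ?thesis by (simp only: ac_simps)
qed

section \<open>Adapted densities and the submartingale of their p-th moments\<close>

context measure_martingale
begin

context
  fixes lam :: "'a measure" and f :: "nat \<Rightarrow> 'w \<Rightarrow> 'a \<Rightarrow> real"
  assumes sets_lam [measurable_cong]: "sets lam = sets borel" and sf: "sigma_finite_measure lam"
    and f_meas: "\<And>n \<omega>. \<omega> \<in> space M \<Longrightarrow> f n \<omega> \<in> borel_measurable borel"
    and f_nonneg: "\<And>n \<omega> x. \<omega> \<in> space M \<Longrightarrow> 0 \<le> f n \<omega> x"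
    and f_density: "\<And>n \<omega>. \<omega> \<in> space M \<Longrightarrow> \<alpha>s n \<omega> = density lam (\<lambda>x. ennreal (f n \<omega> x))"
begin

interpretation lam: sigma_finite_measure lam by (rule sf)

lemma adapted_measurable: "g \<in> measurable (F n \<Otimes>\<^sub>M lam) N \<Longrightarrow> g \<in> measurable (M \<Otimes>\<^sub>M lam) N"
  "n \<le> k \<Longrightarrow> g \<in> measurable (F n \<Otimes>\<^sub>M lam) N \<Longrightarrow> g \<in> measurable (F k \<Otimes>\<^sub>M lam) N"
proof -
  have id: "(\<lambda>z. z) \<in> M' \<Otimes>\<^sub>M lam \<rightarrow>\<^sub>M F n \<Otimes>\<^sub>M lam" if "(\<lambda>\<omega>. \<omega>) \<in> M' \<rightarrow>\<^sub>M F n" for M'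
    using measurable_Pair[OF measurable_compose[OF measurable_fst that] measurable_snd[of M' lam]] by simp
  show "g \<in> measurable (M \<Otimes>\<^sub>M lam) N" if "g \<in> measurable (F n \<Otimes>\<^sub>M lam) N"
    by (rule measurable_compose[OF id[OF measurable_F_M[OF measurable_ident[unfolded id_def]]] that])
  show "g \<in> measurable (F k \<Otimes>\<^sub>M lam) N" if "n \<le> k" "g \<in> measurable (F n \<Otimes>\<^sub>M lam) N"
    by (rule measurable_compose[OF id[OF measurable_F_mono[OF that(1) measurable_ident[unfolded id_def]]] that(2)])
qed

text \<open>
  The product measure carries only the \<open>n\<close>-th stage of the filtration: this makes the density of the joint
  law adapted.
\<close>

definition joint_law :: "nat \<Rightarrow> ('w \<Rightarrow> 'a measure) \<Rightarrow> ('w \<times> 'a) measure" where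
  "joint_law n \<beta> = M \<bind> (\<lambda>\<omega>. distr (\<beta> \<omega>) (F n \<Otimes>\<^sub>M lam) (Pair \<omega>))"

context
  fixes \<beta> :: "'w \<Rightarrow> 'a measure" assumes \<beta>: "\<beta> \<in> M \<rightarrow>\<^sub>M prob_algebra borel"
begin

lemma joint_law_kernel:
  "(\<lambda>\<omega>. distr (\<beta> \<omega>) (F n \<Otimes>\<^sub>M lam) (Pair \<omega>)) \<in> M \<rightarrow>\<^sub>M subprob_algebra (F n \<Otimes>\<^sub>M lam)"
proof (rule measurable_distr2)
  show "\<beta> \<in> M \<rightarrow>\<^sub>M subprob_algebra lam"
    using measurable_prob_algebraD[OF \<beta>] subprob_algebra_cong[OF sets_lam] by simp
  have "(\<lambda>z. z) \<in> F n \<Otimes>\<^sub>M lam \<rightarrow>\<^sub>M F n \<Otimes>\<^sub>M lam" by simp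
  from adapted_measurable(1)[OF this] show "case_prod Pair \<in> M \<Otimes>\<^sub>M lam \<rightarrow>\<^sub>M F n \<Otimes>\<^sub>M lam"
    by (simp add: case_prod_Pair id_def)
qed

lemma sets_joint_law [measurable_cong]: "sets (joint_law n \<beta>) = sets (F n \<Otimes>\<^sub>M lam)"
  unfolding joint_law_def using not_empty by (intro sets_bind) auto

lemma nn_integral_joint_law:
  assumes g: "g \<in> borel_measurable (F n \<Otimes>\<^sub>M lam)"
  shows "(\<integral>\<^sup>+z. g z \<partial>joint_law n \<beta>) = (\<integral>\<^sup>+\<omega>. \<integral>\<^sup>+x. g (\<omega>, x) \<partial>\<beta> \<omega> \<partial>M)"
  unfolding joint_law_def nn_integral_bind[OF g joint_law_kernel]
proof (rule nn_integral_cong)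
  fix \<omega> assume \<omega>: "\<omega> \<in> space M"
  have "sets (\<beta> \<omega>) = sets lam"
    using measurable_space[OF \<beta> \<omega>] sets_lam by (simp add: space_prob_algebra)
  then have "Pair \<omega> \<in> \<beta> \<omega> \<rightarrow>\<^sub>M F n \<Otimes>\<^sub>M lam"
    using \<omega> measurable_Pair1'[of \<omega> "F n" lam] by (simp add: space_F cong: measurable_cong_sets)
  then show "(\<integral>\<^sup>+z. g z \<partial>distr (\<beta> \<omega>) (F n \<Otimes>\<^sub>M lam) (Pair \<omega>)) = (\<integral>\<^sup>+x. g (\<omega>, x) \<partial>\<beta> \<omega>)"
    using g by (intro nn_integral_distr) auto
qed

lemma emeasure_joint_law_times:
  assumes A: "A \<in> sets (F n)" and B: "B \<in> sets lam"
  shows "emeasure (joint_law n \<beta>) (A \<times> B) = (\<integral>\<^sup>+\<omega>\<in>A. emeasure (\<beta> \<omega>) B \<partial>M)"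
proof -
  have AB [measurable]: "A \<times> B \<in> sets (F n \<Otimes>\<^sub>M lam)" using A B by auto
  have "emeasure (joint_law n \<beta>) (A \<times> B) = (\<integral>\<^sup>+z. indicator (A \<times> B) z \<partial>joint_law n \<beta>)"
    using AB by (intro nn_integral_indicator[symmetric]) (simp add: sets_joint_law)
  also have "\<dots> = (\<integral>\<^sup>+\<omega>. \<integral>\<^sup>+x. indicator (A \<times> B) (\<omega>, x) \<partial>\<beta> \<omega> \<partial>M)"
    by (rule nn_integral_joint_law) measurable
  also have "\<dots> = (\<integral>\<^sup>+\<omega>\<in>A. emeasure (\<beta> \<omega>) B \<partial>M)"
  proof (rule nn_integral_cong)
    fix \<omega> assume "\<omega> \<in> space M"
    then have "sets (\<beta> \<omega>) = sets lam"
      using measurable_space[OF \<beta>] sets_lam by (simp add: space_prob_algebra)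
    then show "(\<integral>\<^sup>+x. indicator (A \<times> B) (\<omega>, x) \<partial>\<beta> \<omega>) = emeasure (\<beta> \<omega>) B * indicator A \<omega>"
      using B by (cases "\<omega> \<in> A") (auto simp: indicator_times)
  qed
  finally show ?thesis .
qed

end

text \<open>On rectangles with first side in \<open>F n\<close> this is the defining property of
  conditional expectation. The restriction to stage \<open>n\<close> is essential: the law may
  differ on finer sigma-fields.\<close>

lemma joint_law_eq: "joint_law n (\<alpha>s n) = joint_law n \<alpha>"
proof (rule measure_eqI_generator_eq[OF Int_stable_pair_measure_generator[of "F n" lam]])
  show "{a \<times> b |a b. a \<in> sets (F n) \<and> b \<in> sets lam} \<subseteq> Pow (space (F n) \<times> space lam)"
    by (rule pair_measure_closed)
  show "sets (joint_law n (\<alpha>s n)) = sigma_sets (space (F n) \<times> space lam) {a \<times> b |a b. a \<in> sets (F n) \<and> b \<in> sets lam}"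
    "sets (joint_law n \<alpha>) = sigma_sets (space (F n) \<times> space lam) {a \<times> b |a b. a \<in> sets (F n) \<and> b \<in> sets lam}"
    by (rule trans[OF sets_joint_law[OF kernels] sets_pair_measure],
        rule trans[OF sets_joint_law[OF kernel] sets_pair_measure])
  fix X assume "X \<in> {a \<times> b |a b. a \<in> sets (F n) \<and> b \<in> sets lam}"
  then obtain A B where X: "X = A \<times> B" "A \<in> sets (F n)" "B \<in> sets lam" by blast
  have Bb: "B \<in> sets borel" using X(3) sets_lam by simp
  have "(\<integral>\<^sup>+\<omega>\<in>A. emeasure (\<alpha>s n \<omega>) B \<partial>M) = (\<integral>\<^sup>+\<omega>\<in>A. nn_cond_exp M (F n) (\<lambda>\<omega>. emeasure (\<alpha> \<omega>) B) \<omega> \<partial>M)"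
    using kernels_cond_exp[OF Bb, of n] by (intro nn_integral_cong_AE) auto
  also have "\<dots> = (\<integral>\<^sup>+\<omega>\<in>A. emeasure (\<alpha> \<omega>) B \<partial>M)"
    by (intro nn_cond_exp_set_integral X(2) borel_measurable_emeasure_kernel Bb)
  finally show "emeasure (joint_law n (\<alpha>s n)) X = emeasure (joint_law n \<alpha>) X"
    unfolding X(1) by (simp add: emeasure_joint_law_times kernel kernels X(2,3))
next
  have top: "space (F n) \<in> sets (F n)" "space lam \<in> sets lam" by auto
  show "range (\<lambda>i::nat. space (F n) \<times> space lam) \<subseteq> {a \<times> b |a b. a \<in> sets (F n) \<and> b \<in> sets lam}"
    using top by blast
  show "(\<Union>i::nat. space (F n) \<times> space lam) = space (F n) \<times> space lam" by simp
  have "(\<integral>\<^sup>+\<omega>\<in>space (F n). emeasure (\<alpha>s n \<omega>) (space lam) \<partial>M) \<le> (\<integral>\<^sup>+\<omega>. 1 \<partial>M)"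
    by (intro nn_integral_mono)
      (auto simp: indicator_def intro: prob_space.emeasure_le_1 prob_kernel(2))
  then show "emeasure (joint_law n (\<alpha>s n)) (space (F n) \<times> space lam) \<noteq> \<infinity>"
    by (auto simp: emeasure_joint_law_times kernels top emeasure_space_1 top_unique)
qed

text \<open>The density is the Radon-Nikodym derivative of the joint law with respect to the product
  of \<open>lam\<close> and the restriction of \<open>M\<close> to stage \<open>n\<close>. The last
  property is the martingale property of densities: its right side does not involve
  \<open>n\<close>, so derivatives of different stages can be exchanged against an integrand
  measurable at the earlier one.\<close>

lemma adapted_density:
  obtains \<delta> :: "'w \<times> 'a \<Rightarrow> real" where "\<delta> \<in> borel_measurable (F n \<Otimes>\<^sub>M lam)" "\<And>z. 0 \<le> \<delta> z"
    "AE \<omega> in M. AE x in lam. \<delta> (\<omega>, x) = f n \<omega> x"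
    "\<And>g. g \<in> borel_measurable (F n \<Otimes>\<^sub>M lam) \<Longrightarrow>
      (\<integral>\<^sup>+z. g z * ennreal (\<delta> z) \<partial>(M \<Otimes>\<^sub>M lam)) = (\<integral>\<^sup>+\<omega>. \<integral>\<^sup>+x. g (\<omega>, x) \<partial>\<alpha> \<omega> \<partial>M)"
proof -
  \<comment> \<open>Restricting \<open>M\<close> beforehand is what makes the derivative measurable
    at stage \<open>n\<close> in its first argument.\<close>
  let ?R = "restr_to_subalg M (F n)"
  let ?Q = "joint_law n (\<alpha>s n)"
  interpret R: prob_space ?R by (rule prob_space_restr_to_subalg[OF subalg prob_space_axioms])
  interpret RL: pair_sigma_finite ?R lam by unfold_locales
  interpret P: pair_sigma_finite M lam by unfold_locales
  have sets_R: "sets (?R \<Otimes>\<^sub>M lam) = sets (F n \<Otimes>\<^sub>M lam)"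
    by (intro sets_pair_measure_cong sets_restr_to_subalg subalg refl)
  have fst: "(\<integral>\<^sup>+z. g z \<partial>(?R \<Otimes>\<^sub>M lam)) = (\<integral>\<^sup>+z. g z \<partial>(M \<Otimes>\<^sub>M lam))"
    if g: "g \<in> borel_measurable (F n \<Otimes>\<^sub>M lam)" for g
  proof -
    have "(\<integral>\<^sup>+z. g z \<partial>(?R \<Otimes>\<^sub>M lam)) = (\<integral>\<^sup>+\<omega>. \<integral>\<^sup>+x. g (\<omega>, x) \<partial>lam \<partial>?R)"
      using g by (intro lam.nn_integral_fst[symmetric]) (subst measurable_cong_sets[OF sets_R refl])
    also have "\<dots> = (\<integral>\<^sup>+\<omega>. \<integral>\<^sup>+x. g (\<omega>, x) \<partial>lam \<partial>M)"
      by (intro nn_integral_subalgebra2[OF subalg] lam.borel_measurable_nn_integral_fst g)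
    also have "\<dots> = (\<integral>\<^sup>+z. g z \<partial>(M \<Otimes>\<^sub>M lam))"
      by (intro lam.nn_integral_fst adapted_measurable(1)[OF g])
    finally show ?thesis .
  qed
  have "absolutely_continuous (?R \<Otimes>\<^sub>M lam) ?Q"
    unfolding absolutely_continuous_def
  proof
    fix C assume "C \<in> null_sets (?R \<Otimes>\<^sub>M lam)"
    then have C: "C \<in> sets (F n \<Otimes>\<^sub>M lam)" "emeasure (?R \<Otimes>\<^sub>M lam) C = 0" by (auto simp: sets_R)
    have Cx: "Pair \<omega> -` C \<in> sets lam" for \<omega> using sets_Pair1[OF C(1)] .
    have im: "indicator C \<in> borel_measurable (F n \<Otimes>\<^sub>M lam)" using C(1) by (rule borel_measurable_indicator)
    have "0 = (\<integral>\<^sup>+z. indicator C z \<partial>(?R \<Otimes>\<^sub>M lam))"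
      using C by (simp add: sets_R)
    also have "\<dots> = (\<integral>\<^sup>+z. indicator C z \<partial>(M \<Otimes>\<^sub>M lam))" by (rule fst[OF im])
    also have "\<dots> = (\<integral>\<^sup>+\<omega>. \<integral>\<^sup>+x. indicator C (\<omega>, x) \<partial>lam \<partial>M)"
      by (intro lam.nn_integral_fst[symmetric] adapted_measurable(1)[OF im])
    finally have "AE \<omega> in M. (\<integral>\<^sup>+x. indicator C (\<omega>, x) \<partial>lam) = 0"
      using lam.borel_measurable_nn_integral_fst[OF adapted_measurable(1)[OF im]]
      by (subst (asm) eq_commute) (simp add: nn_integral_0_iff_AE)
    then have "AE \<omega> in M. (\<integral>\<^sup>+x. indicator C (\<omega>, x) \<partial>\<alpha>s n \<omega>) = 0"
      using AE_space
    proof eventually_elim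
      case (elim \<omega>)
      have ind: "indicator C (\<omega>, x) = (indicator (Pair \<omega> -` C) x :: ennreal)" for x
        by (simp add: indicator_def)
      have "Pair \<omega> -` C \<in> null_sets lam"
        using elim(1) Cx[of \<omega>] by (simp add: ind null_sets_def)
      moreover have "(\<lambda>x. ennreal (f n \<omega> x)) \<in> borel_measurable lam"
        using f_meas[OF elim(2), of n] by (simp cong: measurable_cong_sets add: sets_lam)
      ultimately have "Pair \<omega> -` C \<in> null_sets (density lam (\<lambda>x. ennreal (f n \<omega> x)))"
        using absolutely_continuousI_density by (auto simp: absolutely_continuous_def)
      then show ?case
        using Cx[of \<omega>] by (simp add: ind f_density[OF elim(2)] null_setsD1)
    qed
    then have "(\<integral>\<^sup>+\<omega>. \<integral>\<^sup>+x. indicator C (\<omega>, x) \<partial>\<alpha>s n \<omega> \<partial>M) = (\<integral>\<^sup>+\<omega>. 0 \<partial>M)"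
      by (rule nn_integral_cong_AE)
    then have "(\<integral>\<^sup>+z. indicator C z \<partial>?Q) = 0"
      by (simp add: nn_integral_joint_law[OF kernels im])
    then show "C \<in> null_sets ?Q"
      using C(1) by (auto simp: null_sets_def sets_joint_law kernels)
  qed
  moreover have "sets ?Q = sets (?R \<Otimes>\<^sub>M lam)" by (simp add: sets_R sets_joint_law kernels)
  ultimately have dens: "density (?R \<Otimes>\<^sub>M lam) (RN_deriv (?R \<Otimes>\<^sub>M lam) ?Q) = ?Q"
    by (rule RL.density_RN_deriv)
  define d where "d = RN_deriv (?R \<Otimes>\<^sub>M lam) ?Q"
  have dR: "d \<in> borel_measurable (?R \<Otimes>\<^sub>M lam)" unfolding d_def by measurable
  then have dF [measurable]: "d \<in> borel_measurable (F n \<Otimes>\<^sub>M lam)"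
    by (subst (asm) measurable_cong_sets[OF sets_R refl])
  have dM [measurable]: "d \<in> borel_measurable (M \<Otimes>\<^sub>M lam)" by (rule adapted_measurable(1)[OF dF])
  have int: "(\<integral>\<^sup>+z. g z * d z \<partial>(M \<Otimes>\<^sub>M lam)) = (\<integral>\<^sup>+\<omega>. \<integral>\<^sup>+x. g (\<omega>, x) \<partial>\<alpha> \<omega> \<partial>M)"
    if g [measurable]: "g \<in> borel_measurable (F n \<Otimes>\<^sub>M lam)" for g
  proof -
    have gR: "g \<in> borel_measurable (?R \<Otimes>\<^sub>M lam)" using g by (subst measurable_cong_sets[OF sets_R refl])
    have "(\<integral>\<^sup>+z. g z * d z \<partial>(M \<Otimes>\<^sub>M lam)) = (\<integral>\<^sup>+z. g z * d z \<partial>(?R \<Otimes>\<^sub>M lam))"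
      by (rule fst[symmetric]) measurable
    also have "\<dots> = (\<integral>\<^sup>+z. g z \<partial>density (?R \<Otimes>\<^sub>M lam) d)"
      using dR gR by (subst nn_integral_density) (auto simp: mult.commute)
    also have "\<dots> = (\<integral>\<^sup>+z. g z \<partial>joint_law n \<alpha>)"
      using dens by (simp add: d_def joint_law_eq)
    also have "\<dots> = (\<integral>\<^sup>+\<omega>. \<integral>\<^sup>+x. g (\<omega>, x) \<partial>\<alpha> \<omega> \<partial>M)"
      by (rule nn_integral_joint_law[OF kernel g])
    finally show ?thesis .
  qed
  have dx [measurable]: "(\<lambda>x. d (\<omega>, x)) \<in> borel_measurable lam" if "\<omega> \<in> space M" for \<omega>
    using measurable_compose[OF measurable_Pair1'[of \<omega> M lam] dM] that by simp
  \<comment> \<open>For a fixed Borel set the section integral of \<open>d\<close> is measurable at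
    stage \<open>n\<close> and has the right integrals over events of that stage, so it is a version
    of the conditional expectation.\<close>
  have marg: "AE \<omega> in M. emeasure (\<alpha>s n \<omega>) B = (\<integral>\<^sup>+x. d (\<omega>, x) * indicator B x \<partial>lam)"
    if B: "B \<in> sets borel" for B
  proof -
    have [measurable]: "B \<in> sets lam" using B sets_lam by simp
    have mF: "(\<lambda>\<omega>. \<integral>\<^sup>+x. d (\<omega>, x) * indicator B x \<partial>lam) \<in> borel_measurable (F n)"
      by measurable
    have "AE \<omega> in M. (\<integral>\<^sup>+x. d (\<omega>, x) * indicator B x \<partial>lam) = nn_cond_exp M (F n) (\<lambda>\<omega>. emeasure (\<alpha> \<omega>) B) \<omega>"
    proof (rule sigma_finite_subalgebra.nn_cond_exp_charact[OF F_sigma_finite_subalgebra])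
      fix A assume A [measurable]: "A \<in> sets (F n)"
      have [measurable]: "A \<in> sets M" using A by (rule sets_F)
      have "(\<integral>\<^sup>+\<omega>\<in>A. emeasure (\<alpha> \<omega>) B \<partial>M) = emeasure (joint_law n \<alpha>) (A \<times> B)"
        by (simp add: emeasure_joint_law_times kernel A)
      also have "\<dots> = (\<integral>\<^sup>+z. indicator (A \<times> B) z \<partial>joint_law n \<alpha>)"
        by (rule nn_integral_indicator[symmetric]) (simp add: sets_joint_law kernel A)
      also have "\<dots> = (\<integral>\<^sup>+z. indicator (A \<times> B) z * d z \<partial>(M \<Otimes>\<^sub>M lam))"
        by (simp add: nn_integral_joint_law[OF kernel] int)
      also have "\<dots> = (\<integral>\<^sup>+\<omega>. \<integral>\<^sup>+x. indicator (A \<times> B) (\<omega>, x) * d (\<omega>, x) \<partial>lam \<partial>M)"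
        by (rule lam.nn_integral_fst[symmetric]) measurable
      also have "\<dots> = (\<integral>\<^sup>+\<omega>\<in>A. (\<integral>\<^sup>+x. d (\<omega>, x) * indicator B x \<partial>lam) \<partial>M)"
        by (intro nn_integral_cong) (auto simp: indicator_times mult.commute split: split_indicator)
      finally show "(\<integral>\<^sup>+\<omega>\<in>A. emeasure (\<alpha> \<omega>) B \<partial>M) = (\<integral>\<^sup>+\<omega>\<in>A. (\<integral>\<^sup>+x. d (\<omega>, x) * indicator B x \<partial>lam) \<partial>M)" .
    qed (use mF B in \<open>auto intro: borel_measurable_emeasure_kernel\<close>)
    with kernels_cond_exp[OF B, of n] show ?thesis by eventually_elim simp
  qed
  \<comment> \<open>The null sets in \<open>marg\<close> depend on \<open>B\<close>. The countable
    family removes this dependence and identifies the measures, and uniqueness of densities then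
    identifies the sections of \<open>d\<close> with \<open>f n \<omega>\<close>.\<close>
  obtain \<V> :: "'a set set" where \<V>: "countable \<V>" "\<And>V. V \<in> \<V> \<Longrightarrow> open V"
    "\<And>U. open U \<Longrightarrow> \<exists>W::nat \<Rightarrow> 'a set. range W \<subseteq> \<V> \<and> incseq W \<and> U = \<Union>(range W)"
    using open_union_of_countable_family by blast
  have "AE \<omega> in M. \<forall>V\<in>\<V>. emeasure (\<alpha>s n \<omega>) V = (\<integral>\<^sup>+x. d (\<omega>, x) * indicator V x \<partial>lam)"
    using \<V>(1,2) by (simp add: AE_ball_countable marg)
  then have d_eq: "AE \<omega> in M. AE x in lam. d (\<omega>, x) = ennreal (f n \<omega> x)"
    using AE_space
  proof eventually_elim
    case (elim \<omega>)
    have fm: "(\<lambda>x. ennreal (f n \<omega> x)) \<in> borel_measurable lam"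
      using f_meas[OF elim(2), of n] by (simp cong: measurable_cong_sets add: sets_lam)
    have "\<alpha>s n \<omega> = density lam (\<lambda>x. d (\<omega>, x))"
    proof (rule finite_borel_measure_eqI_countable[OF _ _ _ \<V>(2,3)])
      show "emeasure (\<alpha>s n \<omega>) UNIV \<noteq> \<infinity>"
        using prob_space.emeasure_le_1[OF prob_kernel(2)[OF elim(2)], of n UNIV] by (auto simp: top_unique)
      fix V assume V: "V \<in> \<V>"
      then have "V \<in> sets lam" using \<V>(2) sets_lam by auto
      then show "emeasure (\<alpha>s n \<omega>) V = emeasure (density lam (\<lambda>x. d (\<omega>, x))) V"
        using elim V by (simp add: emeasure_density dx)
    qed (auto simp: sets_kernel elim(2) sets_lam)
    then have "density lam (\<lambda>x. d (\<omega>, x)) = density lam (\<lambda>x. ennreal (f n \<omega> x))"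
      by (simp add: f_density[OF elim(2)])
    then show ?case
      using lam.density_unique_iff[OF dx[OF elim(2)] fm] by simp
  qed
  show thesis
  proof (rule that[of "\<lambda>z. enn2real (d z)"])
    show "AE \<omega> in M. AE x in lam. enn2real (d (\<omega>, x)) = f n \<omega> x"
      using d_eq AE_space
    proof eventually_elim
      case (elim \<omega>)
      from elim(1) show ?case by eventually_elim (simp add: f_nonneg elim(2))
    qed
    \<comment> \<open>Agreement of \<open>d\<close> with the real valued \<open>f n\<close> is known
      only iterated, first in \<omega> and then in x. Finiteness of \<open>d\<close> is a measurable
      condition, so for it the iterated statement becomes one on the product.\<close>
    have "AE z in M \<Otimes>\<^sub>M lam. d z \<noteq> \<infinity>"
    proof (rule P.AE_pair_measure)
      show "AE \<omega> in M. AE x in lam. d (\<omega>, x) \<noteq> \<infinity>"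
        using d_eq
      proof eventually_elim
        case (elim \<omega>)
        then show ?case by eventually_elim simp
      qed
    qed measurable
    then have "AE z in M \<Otimes>\<^sub>M lam. ennreal (enn2real (d z)) = d z"
      by eventually_elim (simp add: less_top)
    fix g :: "'w \<times> 'a \<Rightarrow> ennreal" assume g: "g \<in> borel_measurable (F n \<Otimes>\<^sub>M lam)"
    have "(\<integral>\<^sup>+z. g z * ennreal (enn2real (d z)) \<partial>(M \<Otimes>\<^sub>M lam)) = (\<integral>\<^sup>+z. g z * d z \<partial>(M \<Otimes>\<^sub>M lam))"
      using \<open>AE z in M \<Otimes>\<^sub>M lam. ennreal (enn2real (d z)) = d z\<close> by (intro nn_integral_cong_AE) auto
    then show "(\<integral>\<^sup>+z. g z * ennreal (enn2real (d z)) \<partial>(M \<Otimes>\<^sub>M lam)) = (\<integral>\<^sup>+\<omega>. \<integral>\<^sup>+x. g (\<omega>, x) \<partial>\<alpha> \<omega> \<partial>M)"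
      using int[OF g] by simp
  qed (auto)
qed

text \<open>The conditional Jensen inequality behind the submartingale property is obtained in
  integrated form: the tangent inequality is integrated over \<open>A \<times> K\<close>, and its
  linear term is exchanged between stages by the last property of
  \<open>adapted_density\<close>.\<close>

lemma AE_SUP_powr_finite:
  assumes K: "K \<in> sets borel" "emeasure lam K < \<infinity>" and p: "1 < p"
    and C: "C < \<infinity>" "\<And>n. (\<integral>\<^sup>+\<omega>. (\<integral>\<^sup>+x\<in>K. ennreal (f n \<omega> x powr p) \<partial>lam) \<partial>M) \<le> C"
  shows "AE \<omega> in M. (SUP n. \<integral>\<^sup>+x\<in>K. ennreal (f n \<omega> x powr p) \<partial>lam) < \<infinity>"
proof -
  have KL [measurable]: "K \<in> sets lam" using K(1) sets_lam by simp
  have "\<forall>n. \<exists>\<delta>. \<delta> \<in> borel_measurable (F n \<Otimes>\<^sub>M lam) \<and> (\<forall>z. 0 \<le> \<delta> z) \<and>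
    (AE \<omega> in M. AE x in lam. \<delta> (\<omega>, x) = f n \<omega> x) \<and>
    (\<forall>g. g \<in> borel_measurable (F n \<Otimes>\<^sub>M lam) \<longrightarrow>
      (\<integral>\<^sup>+z. g z * ennreal (\<delta> z) \<partial>(M \<Otimes>\<^sub>M lam)) = (\<integral>\<^sup>+\<omega>. \<integral>\<^sup>+x. g (\<omega>, x) \<partial>\<alpha> \<omega> \<partial>M))"
  proof
    fix n
    obtain \<delta> :: "'w \<times> 'a \<Rightarrow> real" where "\<delta> \<in> borel_measurable (F n \<Otimes>\<^sub>M lam)" "\<And>z. 0 \<le> \<delta> z"
      "AE \<omega> in M. AE x in lam. \<delta> (\<omega>, x) = f n \<omega> x"
      "\<And>g. g \<in> borel_measurable (F n \<Otimes>\<^sub>M lam) \<Longrightarrow>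
        (\<integral>\<^sup>+z. g z * ennreal (\<delta> z) \<partial>(M \<Otimes>\<^sub>M lam)) = (\<integral>\<^sup>+\<omega>. \<integral>\<^sup>+x. g (\<omega>, x) \<partial>\<alpha> \<omega> \<partial>M)"
      using adapted_density[of n] by blast
    then show "\<exists>\<delta>. \<delta> \<in> borel_measurable (F n \<Otimes>\<^sub>M lam) \<and> (\<forall>z. 0 \<le> \<delta> z) \<and>
      (AE \<omega> in M. AE x in lam. \<delta> (\<omega>, x) = f n \<omega> x) \<and>
      (\<forall>g. g \<in> borel_measurable (F n \<Otimes>\<^sub>M lam) \<longrightarrow>
        (\<integral>\<^sup>+z. g z * ennreal (\<delta> z) \<partial>(M \<Otimes>\<^sub>M lam)) = (\<integral>\<^sup>+\<omega>. \<integral>\<^sup>+x. g (\<omega>, x) \<partial>\<alpha> \<omega> \<partial>M))"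
      by (intro exI[of _ \<delta>] conjI allI impI)
  qed
  from choice[OF this] obtain \<delta> :: "nat \<Rightarrow> 'w \<times> 'a \<Rightarrow> real" where \<delta>_all:
    "\<forall>n. \<delta> n \<in> borel_measurable (F n \<Otimes>\<^sub>M lam) \<and> (\<forall>z. 0 \<le> \<delta> n z) \<and>
      (AE \<omega> in M. AE x in lam. \<delta> n (\<omega>, x) = f n \<omega> x) \<and>
      (\<forall>g. g \<in> borel_measurable (F n \<Otimes>\<^sub>M lam) \<longrightarrow>
        (\<integral>\<^sup>+z. g z * ennreal (\<delta> n z) \<partial>(M \<Otimes>\<^sub>M lam)) = (\<integral>\<^sup>+\<omega>. \<integral>\<^sup>+x. g (\<omega>, x) \<partial>\<alpha> \<omega> \<partial>M))"
    by (rule exE)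
  then have \<delta>F [measurable]: "\<delta> n \<in> borel_measurable (F n \<Otimes>\<^sub>M lam)" and \<delta>0: "0 \<le> \<delta> n z"
    and \<delta>f: "AE \<omega> in M. AE x in lam. \<delta> n (\<omega>, x) = f n \<omega> x"
    and \<delta>int: "g \<in> borel_measurable (F n \<Otimes>\<^sub>M lam) \<Longrightarrow>
      (\<integral>\<^sup>+z. g z * ennreal (\<delta> n z) \<partial>(M \<Otimes>\<^sub>M lam)) = (\<integral>\<^sup>+\<omega>. \<integral>\<^sup>+x. g (\<omega>, x) \<partial>\<alpha> \<omega> \<partial>M)" for n z g
    by blast+
  have \<delta>M [measurable]: "\<delta> n \<in> borel_measurable (M \<Otimes>\<^sub>M lam)" for n by (rule adapted_measurable(1)[OF \<delta>F])
  \<comment> \<open>An adapted version of the moments in the claim. By \<open>Yf\<close> they agree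
    almost surely, so bounds on the mean and on the supremum carry over.\<close>
  define Y where "Y n \<omega> = (\<integral>\<^sup>+x\<in>K. ennreal (\<delta> n (\<omega>, x) powr p) \<partial>lam)" for n \<omega>
  have YF: "Y n \<in> borel_measurable (F n)" for n
    unfolding Y_def by measurable
  have YM [measurable]: "Y n \<in> borel_measurable M" for n using YF by (rule measurable_F_M)
  have Yf: "AE \<omega> in M. Y n \<omega> = (\<integral>\<^sup>+x\<in>K. ennreal (f n \<omega> x powr p) \<partial>lam)" for n
    using \<delta>f[of n]
  proof eventually_elim
    case (elim \<omega>)
    show ?case unfolding Y_def
      by (rule nn_integral_cong_AE) (use elim in eventually_elim, simp)
  qed
  have times: "(\<integral>\<^sup>+z. h z * indicator (A \<times> K) z \<partial>(M \<Otimes>\<^sub>M lam)) = (\<integral>\<^sup>+\<omega>\<in>A. (\<integral>\<^sup>+x\<in>K. h (\<omega>, x) \<partial>lam) \<partial>M)"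
    if [measurable]: "h \<in> borel_measurable (M \<Otimes>\<^sub>M lam)" "A \<in> sets M" for h :: "'w \<times> 'a \<Rightarrow> ennreal" and A
  proof -
    have "(\<integral>\<^sup>+z. h z * indicator (A \<times> K) z \<partial>(M \<Otimes>\<^sub>M lam)) = (\<integral>\<^sup>+\<omega>. \<integral>\<^sup>+x. h (\<omega>, x) * indicator (A \<times> K) (\<omega>, x) \<partial>lam \<partial>M)"
      by (rule lam.nn_integral_fst[symmetric]) measurable
    also have "\<dots> = (\<integral>\<^sup>+\<omega>\<in>A. (\<integral>\<^sup>+x\<in>K. h (\<omega>, x) \<partial>lam) \<partial>M)"
      by (intro nn_integral_cong) (auto simp: indicator_times split: split_indicator)
    finally show ?thesis .
  qed
  have sub: "(\<integral>\<^sup>+\<omega>\<in>A. Y n \<omega> \<partial>M) \<le> (\<integral>\<^sup>+\<omega>\<in>A. Y k \<omega> \<partial>M)" if nk: "n \<le> k" and A: "A \<in> sets (F n)" for n k A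
  proof -
    have AM [measurable]: "A \<in> sets M" using A by (rule sets_F)
    note [measurable] = A
    let ?N = "M \<Otimes>\<^sub>M lam"
    \<comment> \<open>The tangent of \<open>t powr p\<close> is taken at a truncation of \<open>\<delta> n\<close>, so that its contribution is finite
      and can be cancelled.\<close>
    define u where "u m z = min (\<delta> n z) (real m)" for m z
    have u0: "0 \<le> u m z" for m z using \<delta>0[of n z] by (simp add: u_def)
    have uF [measurable]: "u m \<in> borel_measurable (F n \<Otimes>\<^sub>M lam)" for m unfolding u_def by measurable
    have uM [measurable]: "u m \<in> borel_measurable ?N" for m by (rule adapted_measurable(1)[OF uF])
    define U where "U m = (\<integral>\<^sup>+z. ennreal (u m z powr p) * indicator (A \<times> K) z \<partial>?N)" for m
    have U_le: "U m \<le> (\<integral>\<^sup>+\<omega>\<in>A. Y k \<omega> \<partial>M)" for m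
    proof -
      \<comment> \<open>The slope of the tangent at \<open>u m\<close>, cut to
        \<open>A \<times> K\<close>. It is measurable at stage \<open>n\<close> and hence at stage
        \<open>k\<close>, so its integrals against \<open>\<delta> n\<close> and
        \<open>\<delta> k\<close> both equal its integral against \<open>\<alpha>\<close>.\<close>
      define g where "g z = ennreal (p * u m z powr (p - 1)) * indicator (A \<times> K) z" for z
      have gF: "g \<in> borel_measurable (F n \<Otimes>\<^sub>M lam)" unfolding g_def by measurable
      have swap: "(\<integral>\<^sup>+z. g z * ennreal (\<delta> n z) \<partial>?N) = (\<integral>\<^sup>+z. g z * ennreal (\<delta> k z) \<partial>?N)"
        using \<delta>int[OF gF] \<delta>int[OF adapted_measurable(2)[OF nk gF]] by simp
      have fin: "ennreal (p - 1) * U m \<noteq> \<infinity>"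
      proof -
        have "U m \<le> (\<integral>\<^sup>+z. ennreal (real m powr p) * indicator (A \<times> K) z \<partial>?N)"
          unfolding U_def using u0 p
          by (intro nn_integral_mono mult_right_mono ennreal_leI powr_mono2) (auto simp: u_def)
        also have "\<dots> = ennreal (real m powr p) * (emeasure M A * emeasure lam K)"
          by (subst nn_integral_cmult_indicator) (auto simp: lam.emeasure_pair_measure_Times)
        also have "\<dots> < \<infinity>"
          using K(2) by (simp add: ennreal_mult_less_top emeasure_eq_measure)
        finally show ?thesis by (simp add: ennreal_mult_eq_top_iff)
      qed
      \<comment> \<open>Since \<open>u m\<close> is at most \<open>\<delta> n\<close>, slope times
        \<open>\<delta> n\<close> dominates \<open>p\<close> times the p-th power of
        \<open>u m\<close>, written here as 1 plus \<open>p - 1\<close> copies. After the exchange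
        of densities the tangent inequality returns the \<open>p - 1\<close> copies, which cancel by
        \<open>fin\<close>.\<close>
      have "U m + ennreal (p - 1) * U m =
          (\<integral>\<^sup>+z. ennreal (u m z powr p) * indicator (A \<times> K) z + ennreal (p - 1) * (ennreal (u m z powr p) * indicator (A \<times> K) z) \<partial>?N)"
        unfolding U_def by (subst nn_integral_add) (auto simp: nn_integral_cmult)
      also have "\<dots> \<le> (\<integral>\<^sup>+z. g z * ennreal (\<delta> n z) \<partial>?N)"
      proof (rule nn_integral_mono)
        fix z
        have "u m z powr p = u m z powr (p - 1) * u m z"
          using u0[of m z] by (cases "u m z = 0") (auto simp: powr_mult_base[symmetric] mult.commute powr_diff)
        then have "u m z powr p + (p - 1) * u m z powr p = p * u m z powr (p - 1) * u m z"
          by (simp add: algebra_simps)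
        also have "\<dots> \<le> p * u m z powr (p - 1) * \<delta> n z"
          using p by (intro mult_left_mono) (auto simp: u_def)
        finally show "ennreal (u m z powr p) * indicator (A \<times> K) z + ennreal (p - 1) * (ennreal (u m z powr p) * indicator (A \<times> K) z) \<le> g z * ennreal (\<delta> n z)"
          using p \<delta>0[of n z] by (auto simp: g_def ennreal_mult[symmetric] ennreal_plus[symmetric] simp del: ennreal_plus split: split_indicator intro!: ennreal_leI)
      qed
      also have "\<dots> = (\<integral>\<^sup>+z. g z * ennreal (\<delta> k z) \<partial>?N)" by (rule swap)
      also have "\<dots> \<le> (\<integral>\<^sup>+z. ennreal (\<delta> k z powr p) * indicator (A \<times> K) z + ennreal (p - 1) * (ennreal (u m z powr p) * indicator (A \<times> K) z) \<partial>?N)"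
      proof (rule nn_integral_mono)
        fix z
        show "g z * ennreal (\<delta> k z) \<le> ennreal (\<delta> k z powr p) * indicator (A \<times> K) z + ennreal (p - 1) * (ennreal (u m z powr p) * indicator (A \<times> K) z)"
          using p \<delta>0[of k z] powr_tangent_inequality[OF p \<delta>0[of k z] u0[of m z]]
          by (auto simp: g_def ennreal_mult[symmetric] ennreal_plus[symmetric] simp del: ennreal_plus split: split_indicator intro!: ennreal_leI)
      qed
      also have "\<dots> = (\<integral>\<^sup>+z. ennreal (\<delta> k z powr p) * indicator (A \<times> K) z \<partial>?N) + ennreal (p - 1) * U m"
        unfolding U_def by (subst nn_integral_add) (auto simp: nn_integral_cmult)
      also have "(\<integral>\<^sup>+z. ennreal (\<delta> k z powr p) * indicator (A \<times> K) z \<partial>?N) = (\<integral>\<^sup>+\<omega>\<in>A. Y k \<omega> \<partial>M)"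
        unfolding Y_def by (rule times) measurable
      finally have "ennreal (p - 1) * U m + U m \<le> ennreal (p - 1) * U m + (\<integral>\<^sup>+\<omega>\<in>A. Y k \<omega> \<partial>M)"
        by (simp only: add.commute)
      with fin show ?thesis unfolding ennreal_add_left_cancel_le by blast
    qed
    have "(\<integral>\<^sup>+\<omega>\<in>A. Y n \<omega> \<partial>M) = (\<integral>\<^sup>+z. ennreal (\<delta> n z powr p) * indicator (A \<times> K) z \<partial>?N)"
      unfolding Y_def by (rule times[symmetric]) measurable
    also have "\<dots> = (\<integral>\<^sup>+z. (SUP m. ennreal (u m z powr p) * indicator (A \<times> K) z) \<partial>?N)"
    proof (rule nn_integral_cong)
      fix z
      obtain m0 :: nat where m0: "\<delta> n z \<le> real m0" using real_arch_simple by blast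
      have "(SUP m. ennreal (u m z powr p) * indicator (A \<times> K) z) = ennreal (\<delta> n z powr p) * indicator (A \<times> K) z"
      proof (rule antisym)
        show "(SUP m. ennreal (u m z powr p) * indicator (A \<times> K) z) \<le> ennreal (\<delta> n z powr p) * indicator (A \<times> K) z"
          using u0 p by (intro SUP_least mult_right_mono ennreal_leI powr_mono2) (auto simp: u_def)
        have "u m0 z = \<delta> n z" using m0 by (simp add: u_def)
        then show "ennreal (\<delta> n z powr p) * indicator (A \<times> K) z \<le> (SUP m. ennreal (u m z powr p) * indicator (A \<times> K) z)"
          by (intro SUP_upper2[of m0]) auto
      qed
      then show "ennreal (\<delta> n z powr p) * indicator (A \<times> K) z = (SUP m. ennreal (u m z powr p) * indicator (A \<times> K) z)" ..
    qed
    also have "\<dots> = (SUP m. U m)"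
      unfolding U_def
    proof (rule nn_integral_monotone_convergence_SUP)
      show "incseq (\<lambda>m z. ennreal (u m z powr p) * indicator (A \<times> K) z)"
        using u0 p unfolding incseq_def le_fun_def
        by (auto intro!: mult_right_mono ennreal_leI powr_mono2 simp: u_def)
    qed measurable
    also have "\<dots> \<le> (\<integral>\<^sup>+\<omega>\<in>A. Y k \<omega> \<partial>M)" using U_le by (rule SUP_least)
    finally show ?thesis .
  qed
  have bound: "(\<integral>\<^sup>+\<omega>. Y n \<omega> \<partial>M) \<le> C" for n
    using C(2)[of n] nn_integral_cong_AE[OF Yf[of n]] by simp
  \<comment> \<open>The event that the moments are unbounded. The maximal inequality at every
    integer level gives \<open>of_nat i * emeasure M N \<le> C\<close>, which forces probability
    0.\<close>
  define N where "N = {\<omega>\<in>space M. \<forall>i::nat. \<exists>n. of_nat i < Y n \<omega>}"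
  have NM: "N \<in> sets M" unfolding N_def by measurable
  have le: "of_nat i * emeasure M N \<le> C" for i :: nat
  proof -
    have "{\<omega>\<in>space M. \<exists>n. of_nat i < Y n \<omega>} \<in> sets M" by measurable
    then have "emeasure M N \<le> emeasure M {\<omega>\<in>space M. \<exists>n. of_nat i < Y n \<omega>}"
      by (intro emeasure_mono) (auto simp: N_def)
    then show ?thesis
      by (rule order_trans[OF mult_left_mono submartingale_maximal_inequality[OF YF sub bound]]) simp
  qed
  have "emeasure M N = 0"
  proof (rule ccontr)
    assume ne: "emeasure M N \<noteq> 0"
    then have pos: "0 < measure M N" by (simp add: emeasure_eq_measure measure_nonneg order_less_le)
    obtain c where c: "C = ennreal c" "0 \<le> c" using C(1) by (cases C) auto
    obtain i :: nat where i: "c < real i * measure M N" using reals_Archimedean3[OF pos] by blast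
    have "ennreal (real i * measure M N) \<le> ennreal c"
      using le[of i] c by (simp add: emeasure_eq_measure ennreal_mult ennreal_of_nat_eq_real_of_nat)
    then show False using i c by (simp add: ennreal_le_iff)
  qed
  then have "AE \<omega> in M. \<exists>i::nat. \<forall>n. Y n \<omega> \<le> of_nat i"
    using NM by (intro AE_I[where N=N]) (auto simp: N_def not_le)
  moreover have "AE \<omega> in M. \<forall>n. Y n \<omega> = (\<integral>\<^sup>+x\<in>K. ennreal (f n \<omega> x powr p) \<partial>lam)"
    using Yf by (simp add: AE_all_countable)
  ultimately show ?thesis
  proof eventually_elim
    case (elim \<omega>)
    then obtain i :: nat where i: "\<And>n. Y n \<omega> \<le> of_nat i" by blast
    have "(SUP n. \<integral>\<^sup>+x\<in>K. ennreal (f n \<omega> x powr p) \<partial>lam) \<le> of_nat i"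
      using i elim(2) by (intro SUP_least) simp
    also have "\<dots> < \<infinity>" by (simp add: ennreal_of_nat_eq_real_of_nat)
    finally show ?case .
  qed
qed

end

end

subsection \<open>Predictive measures\<close>

locale predictive_process = prob_space M for M :: "'w measure" +
  fixes X :: "nat \<Rightarrow> 'w \<Rightarrow> 'a::polish_space" and \<alpha>s :: "nat \<Rightarrow> 'w \<Rightarrow> 'a measure" and \<alpha> :: "'w \<Rightarrow> 'a measure"
  assumes X: "\<And>n. n \<ge> 1 \<Longrightarrow> X n \<in> M \<rightarrow>\<^sub>M borel"
    and cid: "cond_ident_distr M X"
    and predictive: "predictive_measures M X \<alpha>s"
    and directing: "\<alpha> \<in> past_infinity M X \<rightarrow>\<^sub>M prob_algebra borel"
    and weak: "AE \<omega> in M. converges_weakly (\<lambda>n. \<alpha>s n \<omega>) (\<alpha> \<omega>)"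
begin

lemma initial_segment_measurable: "initial_segment X n \<in> M \<rightarrow>\<^sub>M Pi\<^sub>M {1..n} (\<lambda>_. borel)"
proof -
  have "(\<lambda>\<omega>. \<lambda>i\<in>{1..n}. X i \<omega>) \<in> M \<rightarrow>\<^sub>M Pi\<^sub>M {1..n} (\<lambda>_. borel)"
    using X by (intro measurable_restrict) auto
  moreover have "initial_segment X n = (\<lambda>\<omega>. \<lambda>i\<in>{1..n}. X i \<omega>)"
    by (simp add: fun_eq_iff initial_segment_def)
  ultimately show ?thesis by simp
qed

lemma space_past [simp]: "space (past M X n) = space M"
  by (simp add: past_def)

lemma sets_past: "sets (past M X n) = {initial_segment X n -` A \<inter> space M | A. A \<in> sets (Pi\<^sub>M {1..n} (\<lambda>_. borel))}"
  unfolding past_def by (rule sets_vimage_algebra2) (use measurable_space[OF initial_segment_measurable] in auto)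

lemma subalgebra_past: "subalgebra M (past M X n)"
  unfolding subalgebra_def sets_past using measurable_sets[OF initial_segment_measurable] by auto

lemma past_mono:
  assumes "n \<le> k"
  shows "sets (past M X n) \<subseteq> sets (past M X k)"
proof -
  have "initial_segment X k \<in> past M X k \<rightarrow>\<^sub>M Pi\<^sub>M {1..k} (\<lambda>_. borel)"
    unfolding past_def using measurable_space[OF initial_segment_measurable]
    by (intro measurable_vimage_algebra1) auto
  from measurable_compose[OF this measurable_restrict_subset[of "{1..n}" "{1..k}"]]
  have "(\<lambda>\<omega>. restrict (initial_segment X k \<omega>) {1..n}) \<in> past M X k \<rightarrow>\<^sub>M Pi\<^sub>M {1..n} (\<lambda>_. borel)"
    using assms by auto
  moreover have "restrict (initial_segment X k \<omega>) {1..n} = initial_segment X n \<omega>" for \<omega>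
    using assms by (auto simp: initial_segment_def fun_eq_iff)
  ultimately have "initial_segment X n \<in> past M X k \<rightarrow>\<^sub>M Pi\<^sub>M {1..n} (\<lambda>_. borel)" by simp
  from measurable_sets[OF this] show ?thesis by (auto simp: sets_past[of n])
qed

lemma past_sets_M: "A \<in> sets (past M X n) \<Longrightarrow> A \<in> sets M"
  using subalgebra_past[of n] by (auto simp: subalgebra_def)

text \<open>Membership in \<open>A\<close> is decided by the first \<open>n\<close> coordinates, so
  both events are preimages of one product set \<open>E\<close> under the two random vectors whose
  laws agree.\<close>

lemma cond_ident_distr_Suc:
  assumes A: "A \<in> sets (past M X n)" and B: "B \<in> sets borel"
  shows "emeasure M (A \<inter> X (n+2) -` B) = emeasure M (A \<inter> X (n+1) -` B)"
proof -
  let ?P = "\<lambda>n. Pi\<^sub>M {1..n} (\<lambda>_. borel :: 'a measure)"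
  obtain A' where A': "A' \<in> sets (?P n)" "A = initial_segment X n -` A' \<inter> space M"
    using A by (auto simp: sets_past)
  define E where "E = {x\<in>space (?P (n+1)). restrict x {1..n} \<in> A' \<and> x (n+1) \<in> B}"
  have r: "(\<lambda>x. restrict x {1..n}) \<in> ?P (n+1) \<rightarrow>\<^sub>M ?P n" by (intro measurable_restrict_subset) auto
  have c: "(\<lambda>x. x (n+1)) \<in> ?P (n+1) \<rightarrow>\<^sub>M borel" by (intro measurable_component_singleton) auto
  have "E = ((\<lambda>x. restrict x {1..n}) -` A' \<inter> space (?P (n+1))) \<inter> ((\<lambda>x. x (n+1)) -` B \<inter> space (?P (n+1)))"
    by (auto simp: E_def)
  then have E: "E \<in> sets (?P (n+1))"
    using measurable_sets[OF r A'(1)] measurable_sets[OF c B] by auto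
  define T where "T = (\<lambda>\<omega>. \<lambda>i\<in>{1..n+1}. if i = n+1 then X (n+2) \<omega> else X i \<omega>)"
  have T: "T \<in> M \<rightarrow>\<^sub>M ?P (n+1)"
    unfolding T_def using X by (intro measurable_restrict) auto
  have "restrict (T \<omega>) {1..n} = initial_segment X n \<omega>" "T \<omega> (n+1) = X (n+2) \<omega>" for \<omega>
    by (auto simp: T_def initial_segment_def fun_eq_iff)
  then have eT: "T -` E \<inter> space M = A \<inter> X (n+2) -` B"
    using measurable_space[OF T] by (auto simp: E_def A'(2))
  have "restrict (initial_segment X (n+1) \<omega>) {1..n} = initial_segment X n \<omega>" "initial_segment X (n+1) \<omega> (n+1) = X (n+1) \<omega>" for \<omega>
    by (auto simp: initial_segment_def fun_eq_iff)
  then have eI: "initial_segment X (n+1) -` E \<inter> space M = A \<inter> X (n+1) -` B"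
    using measurable_space[OF initial_segment_measurable[of "n+1"]] by (auto simp: E_def A'(2))
  have "distr M (?P (n+1)) T = distr M (?P (n+1)) (initial_segment X (n+1))"
    using cid unfolding cond_ident_distr_def T_def by blast
  then have "emeasure (distr M (?P (n+1)) T) E = emeasure (distr M (?P (n+1)) (initial_segment X (n+1))) E"
    by simp
  then show ?thesis
    unfolding emeasure_distr[OF T E] emeasure_distr[OF initial_segment_measurable E] eT eI .
qed

text \<open>An event of the n-th past stays in all later pasts, so the one-step identity can be
  iterated with \<open>A\<close> fixed.\<close>

lemma cond_ident_distr_later:
  assumes A: "A \<in> sets (past M X n)" and B: "B \<in> sets borel" and "n \<le> k"
  shows "emeasure M (A \<inter> X (k+1) -` B) = emeasure M (A \<inter> X (n+1) -` B)"
  using \<open>n \<le> k\<close>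
proof (induction k rule: dec_induct)
  case (step k)
  have "A \<in> sets (past M X k)" using past_mono[of n k] A step.hyps by auto
  from cond_ident_distr_Suc[OF this B] step.IH show ?case by simp
qed simp

lemma kernel_predictive: "\<alpha>s n \<in> M \<rightarrow>\<^sub>M prob_algebra borel"
  using predictive by (auto simp: predictive_measures_def)

lemma subalgebra_past_infinity: "subalgebra M (past_infinity M X)"
proof -
  have "(\<Union>n. sets (past M X n)) \<subseteq> sets M" using past_sets_M by auto
  then have "sigma_sets (space M) (\<Union>n. sets (past M X n)) \<subseteq> sets M" by (rule sets.sigma_sets_subset)
  moreover have "(\<Union>n. sets (past M X n)) \<subseteq> Pow (space M)"
    using sets.sets_into_space past_sets_M by blast
  ultimately show ?thesis
    unfolding subalgebra_def past_infinity_def by (simp add: space_measure_of_conv)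
qed

lemma kernel_directing: "\<alpha> \<in> M \<rightarrow>\<^sub>M prob_algebra borel"
  by (rule measurable_from_subalg[OF subalgebra_past_infinity directing])

lemma predictive_cond_exp:
  assumes "n \<ge> 1" and B: "B \<in> sets borel"
  shows "AE \<omega> in M. measure (\<alpha>s n \<omega>) B = real_cond_exp M (past M X n) (\<lambda>\<omega>. indicat_real B (X (n+1) \<omega>)) \<omega>"
  using predictive assms by (auto simp: predictive_measures_def)

lemma sigma_finite_subalgebra_past: "sigma_finite_subalgebra M (past M X n)"
  by (intro finite_measure_subalgebra_is_sigma_finite finite_measure_subalgebra.intro
      finite_measure_subalgebra_axioms.intro subalgebra_past finite_measure_axioms)

lemma emeasure_predictive:
  assumes "\<omega> \<in> space M"
  shows "emeasure (\<alpha>s n \<omega>) B = ennreal (measure (\<alpha>s n \<omega>) B)" "measure (\<alpha>s n \<omega>) B \<le> 1"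
proof -
  interpret \<alpha>s: prob_space "\<alpha>s n \<omega>"
    using measurable_space[OF kernel_predictive assms] by (simp add: space_prob_algebra)
  show "emeasure (\<alpha>s n \<omega>) B = ennreal (measure (\<alpha>s n \<omega>) B)" "measure (\<alpha>s n \<omega>) B \<le> 1"
    by (simp_all add: \<alpha>s.emeasure_eq_measure)
qed

lemma predictive_set_integral:
  assumes n: "n \<ge> 1" and A: "A \<in> sets (past M X n)" and B: "B \<in> sets borel"
  shows "(\<integral>\<^sup>+\<omega>\<in>A. emeasure (\<alpha>s n \<omega>) B \<partial>M) = emeasure M (A \<inter> X (n+1) -` B)"
proof -
  have AM [measurable]: "A \<in> sets M" using A by (rule past_sets_M)
  have [measurable]: "(\<lambda>\<omega>. measure (\<alpha>s n \<omega>) B) \<in> borel_measurable M"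
    using measurable_compose[OF kernel_predictive measurable_measure_prob_algebra[OF B]] .
  define h where "h = (\<lambda>\<omega>. indicat_real B (X (n+1) \<omega>))"
  have XM: "X (n+1) \<in> M \<rightarrow>\<^sub>M borel" by (rule X) simp
  have hM [measurable]: "h \<in> borel_measurable M"
    unfolding h_def by (rule measurable_compose[OF XM borel_measurable_indicator[OF B]])
  have hint: "integrable M h"
    using hM by (rule integrable_const_bound[where B=1, rotated]) (auto simp: h_def indicator_def)
  have "(\<integral>\<^sup>+\<omega>\<in>A. emeasure (\<alpha>s n \<omega>) B \<partial>M) = (\<integral>\<^sup>+\<omega>. ennreal (indicator A \<omega> * measure (\<alpha>s n \<omega>) B) \<partial>M)"
    by (intro nn_integral_cong) (simp add: emeasure_predictive(1) split: split_indicator)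
  also have "\<dots> = ennreal (\<integral>\<omega>. indicator A \<omega> * measure (\<alpha>s n \<omega>) B \<partial>M)"
  proof (rule nn_integral_eq_integral)
    show "integrable M (\<lambda>\<omega>. indicator A \<omega> * measure (\<alpha>s n \<omega>) B)"
      by (rule integrable_const_bound[where B=1])
        (auto simp: emeasure_predictive(2) indicator_def)
  qed auto
  also have "(\<integral>\<omega>. indicator A \<omega> * measure (\<alpha>s n \<omega>) B \<partial>M) = (\<integral>\<omega>. indicator A \<omega> * real_cond_exp M (past M X n) h \<omega> \<partial>M)"
    using predictive_cond_exp[OF n B] AM measurable_from_subalg[OF subalgebra_past borel_measurable_cond_exp]
    by (intro integral_cong_AE) (auto simp: h_def)
  also have "\<dots> = (\<integral>\<omega>. indicator A \<omega> * h \<omega> \<partial>M)"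
    using sigma_finite_subalgebra.real_cond_exp_intA[OF sigma_finite_subalgebra_past hint A]
    by (simp add: set_lebesgue_integral_def)
  also have "ennreal (\<integral>\<omega>. indicator A \<omega> * h \<omega> \<partial>M) = (\<integral>\<^sup>+\<omega>. ennreal (indicator A \<omega> * h \<omega>) \<partial>M)"
    using hint integrable_mult_indicator[OF AM hint]
    by (intro nn_integral_eq_integral[symmetric]) (auto simp: h_def)
  also have "\<dots> = (\<integral>\<^sup>+\<omega>. indicator (A \<inter> X (n+1) -` B) \<omega> \<partial>M)"
    by (intro nn_integral_cong) (auto simp: h_def split: split_indicator)
  also have "\<dots> = emeasure M (A \<inter> X (n+1) -` B)"
  proof (rule nn_integral_indicator)
    have "A \<inter> X (n+1) -` B = A \<inter> (X (n+1) -` B \<inter> space M)"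
      using sets.sets_into_space[OF AM] by auto
    then show "A \<inter> X (n+1) -` B \<in> sets M" using measurable_sets[OF XM B] by simp
  qed
  finally show ?thesis .
qed

text \<open>Weak convergence does not reach an arbitrary Borel set \<open>B\<close> directly. The
  identity is therefore proved for whole measures, by testing with continuous functions, and only
  then evaluated at \<open>B\<close>.\<close>

lemma directing_set_integral:
  assumes A: "A \<in> sets (past M X n)" and B: "B \<in> sets borel"
  shows "(\<integral>\<^sup>+\<omega>\<in>A. emeasure (\<alpha> \<omega>) B \<partial>M) = emeasure M (A \<inter> X (n+1) -` B)"
proof -
  have AM [measurable]: "A \<in> sets M" using A by (rule past_sets_M)
  \<comment> \<open>Weighting \<open>M\<close> by \<open>A\<close> makes the integral over
    \<open>A\<close> of a kernel a measure, \<open>?MA \<bind> \<beta>\<close>, so the claim becomes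
    equality of two finite Borel measures.\<close>
  let ?MA = "density M (indicator A)"
  have neA: "space ?MA \<noteq> {}" using not_empty by simp
  have XA: "X (n+1) \<in> ?MA \<rightarrow>\<^sub>M borel" using X[of "n+1"] by simp
  have kern: "\<beta> \<in> ?MA \<rightarrow>\<^sub>M subprob_algebra borel" if "\<beta> \<in> M \<rightarrow>\<^sub>M prob_algebra borel" for \<beta> :: "'w \<Rightarrow> 'a measure"
    using measurable_prob_algebraD[OF that] by simp
  have sets_bind: "sets (?MA \<bind> \<beta>) = sets borel" if "\<beta> \<in> M \<rightarrow>\<^sub>M prob_algebra borel" for \<beta> :: "'w \<Rightarrow> 'a measure"
    using measurable_space[OF that] neA by (intro sets_bind) (auto simp: space_prob_algebra)
  have em: "emeasure (?MA \<bind> \<beta>) C = (\<integral>\<^sup>+\<omega>\<in>A. emeasure (\<beta> \<omega>) C \<partial>M)"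
    if \<beta>: "\<beta> \<in> M \<rightarrow>\<^sub>M prob_algebra borel" and C: "C \<in> sets borel" for \<beta> :: "'w \<Rightarrow> 'a measure" and C
    unfolding emeasure_bind[OF neA kern[OF \<beta>] C]
    using measurable_compose[OF measurable_prob_algebraD[OF \<beta>] measurable_emeasure_subprob_algebra[OF C]]
    by (subst nn_integral_density) (auto simp: mult.commute)
  have emX: "emeasure (distr ?MA borel (X (n+1))) C = emeasure M (A \<inter> X (n+1) -` C)" if C: "C \<in> sets borel" for C
  proof -
    have s: "X (n+1) -` C \<inter> space M \<in> sets M" using measurable_sets[OF X[of "n+1"] C] by simp
    have "emeasure (distr ?MA borel (X (n+1))) C = emeasure ?MA (X (n+1) -` C \<inter> space M)"
      using emeasure_distr[OF XA C] by simp
    also have "\<dots> = (\<integral>\<^sup>+\<omega>. indicator A \<omega> * indicator (X (n+1) -` C \<inter> space M) \<omega> \<partial>M)"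
      using s by (intro emeasure_density) auto
    also have "\<dots> = (\<integral>\<^sup>+\<omega>. indicator (A \<inter> (X (n+1) -` C \<inter> space M)) \<omega> \<partial>M)"
      by (intro nn_integral_cong) (simp split: split_indicator)
    also have "\<dots> = emeasure M (A \<inter> (X (n+1) -` C \<inter> space M))"
      using s by (intro nn_integral_indicator) auto
    also have "A \<inter> (X (n+1) -` C \<inter> space M) = A \<inter> X (n+1) -` C"
      using sets.sets_into_space[OF AM] by auto
    finally show ?thesis .
  qed
  \<comment> \<open>The averaged predictive measures do not change with \<open>k\<close>: here
    conditional identity in distribution is used.\<close>
  have bind_pred: "?MA \<bind> \<alpha>s k = distr ?MA borel (X (n+1))" if k: "n \<le> k" "1 \<le> k" for k
  proof (rule measure_eqI)
    fix C assume "C \<in> sets (?MA \<bind> \<alpha>s k)"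
    then have C: "C \<in> sets borel" by (simp add: sets_bind[OF kernel_predictive])
    have Ak: "A \<in> sets (past M X k)" using past_mono[OF k(1)] A by auto
    show "emeasure (?MA \<bind> \<alpha>s k) C = emeasure (distr ?MA borel (X (n+1))) C"
      unfolding em[OF kernel_predictive C] emX[OF C] predictive_set_integral[OF k(2) Ak C]
      by (rule cond_ident_distr_later[OF A C k(1)])
  qed (simp add: sets_bind[OF kernel_predictive])
  have "distr ?MA borel (X (n+1)) = ?MA \<bind> \<alpha>"
  proof (rule finite_borel_measure_eqI_continuous)
    show "emeasure (distr ?MA borel (X (n+1))) UNIV \<noteq> \<infinity>"
      using emX[of UNIV] by (simp add: emeasure_eq_measure)
    fix h :: "'a \<Rightarrow> real"
    assume h: "continuous_on UNIV h" "\<And>x. 0 \<le> h x" "\<And>x. h x \<le> 1"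
    have hm: "(\<lambda>x. ennreal (h x)) \<in> borel_measurable borel"
      using borel_measurable_continuous_onI[OF h(1)] by simp
    have nn: "(\<integral>\<^sup>+x. ennreal (h x) \<partial>\<mu>) = ennreal (\<integral>x. h x \<partial>\<mu>)" "(\<integral>\<^sup>+x. ennreal (h x) \<partial>\<mu>) \<le> 1"
      if "\<mu> \<in> space (prob_algebra borel)" for \<mu>
    proof -
      interpret \<mu>: prob_space \<mu> using that by (simp add: space_prob_algebra)
      have "h \<in> borel_measurable \<mu>"
        using borel_measurable_continuous_onI[OF h(1)] that
        by (simp add: space_prob_algebra cong: measurable_cong_sets)
      then show "(\<integral>\<^sup>+x. ennreal (h x) \<partial>\<mu>) = ennreal (\<integral>x. h x \<partial>\<mu>)"
        using h by (intro nn_integral_eq_integral \<mu>.integrable_const_bound[where B=1]) auto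
      have "(\<integral>\<^sup>+x. ennreal (h x) \<partial>\<mu>) \<le> (\<integral>\<^sup>+x. 1 \<partial>\<mu>)"
        using h by (intro nn_integral_mono) auto
      then show "(\<integral>\<^sup>+x. ennreal (h x) \<partial>\<mu>) \<le> 1" by (simp add: \<mu>.emeasure_space_1)
    qed
    have meas: "(\<lambda>\<omega>. \<integral>\<^sup>+x. ennreal (h x) \<partial>\<beta> \<omega>) \<in> borel_measurable M"
      if "\<beta> \<in> M \<rightarrow>\<^sub>M prob_algebra borel" for \<beta> :: "'w \<Rightarrow> 'a measure"
      using measurable_compose[OF measurable_prob_algebraD[OF that] nn_integral_measurable_subprob_algebra[OF hm]] .
    have bind: "(\<integral>\<^sup>+x. ennreal (h x) \<partial>(?MA \<bind> \<beta>)) = (\<integral>\<^sup>+\<omega>. (\<integral>\<^sup>+x. ennreal (h x) \<partial>\<beta> \<omega>) * indicator A \<omega> \<partial>M)"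
      if \<beta>: "\<beta> \<in> M \<rightarrow>\<^sub>M prob_algebra borel" for \<beta> :: "'w \<Rightarrow> 'a measure"
      unfolding nn_integral_bind[OF hm kern[OF \<beta>]]
      using meas[OF \<beta>] by (subst nn_integral_density) (auto simp: mult.commute)
    have "(\<lambda>k. \<integral>\<^sup>+\<omega>. (\<integral>\<^sup>+x. ennreal (h x) \<partial>\<alpha>s k \<omega>) * indicator A \<omega> \<partial>M)
        \<longlonglongrightarrow> (\<integral>\<^sup>+\<omega>. (\<integral>\<^sup>+x. ennreal (h x) \<partial>\<alpha> \<omega>) * indicator A \<omega> \<partial>M)"
    proof (rule nn_integral_dominated_convergence[where w="\<lambda>_. 1"])
      show "AE \<omega> in M. (\<lambda>k. (\<integral>\<^sup>+x. ennreal (h x) \<partial>\<alpha>s k \<omega>) * indicator A \<omega>)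
          \<longlonglongrightarrow> (\<integral>\<^sup>+x. ennreal (h x) \<partial>\<alpha> \<omega>) * indicator A \<omega>"
        using weak AE_space
      proof eventually_elim
        case (elim \<omega>)
        have "bounded (range h)"
          using h by (intro boundedI[where B=1]) auto
        then have "(\<lambda>k. \<integral>x. h x \<partial>\<alpha>s k \<omega>) \<longlonglongrightarrow> (\<integral>x. h x \<partial>\<alpha> \<omega>)"
          using elim(1) h(1) by (auto simp: converges_weakly_def)
        then have "(\<lambda>k. ennreal (\<integral>x. h x \<partial>\<alpha>s k \<omega>)) \<longlonglongrightarrow> ennreal (\<integral>x. h x \<partial>\<alpha> \<omega>)"
          by (rule tendsto_ennrealI)
        then have "(\<lambda>k. \<integral>\<^sup>+x. ennreal (h x) \<partial>\<alpha>s k \<omega>) \<longlonglongrightarrow> (\<integral>\<^sup>+x. ennreal (h x) \<partial>\<alpha> \<omega>)"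
          by (simp add: nn(1)[OF measurable_space[OF kernel_predictive elim(2)]] nn(1)[OF measurable_space[OF kernel_directing elim(2)]])
        then show ?case by (cases "\<omega> \<in> A") auto
      qed
      show "AE \<omega> in M. (\<integral>\<^sup>+x. ennreal (h x) \<partial>\<alpha>s k \<omega>) * indicator A \<omega> \<le> 1" for k
        using nn(2)[OF measurable_space[OF kernel_predictive]] by (auto split: split_indicator)
    qed (use meas[OF kernel_predictive] meas[OF kernel_directing] in \<open>auto simp: emeasure_space_1\<close>)
    \<comment> \<open>The sequence is constant from \<open>max n 1\<close> on, so this value is its
      limit. The 1 is there because \<open>predictive_set_integral\<close> starts at index
      1.\<close>
    moreover have "\<forall>\<^sub>F k in sequentially. (\<integral>\<^sup>+\<omega>. (\<integral>\<^sup>+x. ennreal (h x) \<partial>\<alpha>s k \<omega>) * indicator A \<omega> \<partial>M) =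
        (\<integral>\<^sup>+x. ennreal (h x) \<partial>distr ?MA borel (X (n+1)))"
      using eventually_ge_at_top[of "max n 1"]
      by eventually_elim (simp add: bind[OF kernel_predictive, symmetric] bind_pred)
    ultimately have "(\<integral>\<^sup>+\<omega>. (\<integral>\<^sup>+x. ennreal (h x) \<partial>\<alpha> \<omega>) * indicator A \<omega> \<partial>M) = (\<integral>\<^sup>+x. ennreal (h x) \<partial>distr ?MA borel (X (n+1)))"
      by (rule LIMSEQ_unique[OF _ tendsto_eventually])
    then show "(\<integral>\<^sup>+x. ennreal (h x) \<partial>distr ?MA borel (X (n+1))) = (\<integral>\<^sup>+x. ennreal (h x) \<partial>(?MA \<bind> \<alpha>))"
      by (simp add: bind[OF kernel_directing])
  qed (simp_all add: sets_bind[OF kernel_directing])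
  then show ?thesis using em[OF kernel_directing B] emX[OF B] by simp
qed

lemma predictive_eq_cond_exp_directing:
  assumes n: "n \<ge> 1" and B: "B \<in> sets borel"
  shows "AE \<omega> in M. emeasure (\<alpha>s n \<omega>) B = nn_cond_exp M (past M X n) (\<lambda>\<omega>. emeasure (\<alpha> \<omega>) B) \<omega>"
proof -
  \<comment> \<open>Conditional expectations are characterised among functions measurable for the
    past. \<open>\<alpha>s n\<close> is known to be measurable for \<open>M\<close> only, so this
    adapted version takes its place.\<close>
  define g where "g \<omega> = ennreal (real_cond_exp M (past M X n) (\<lambda>\<omega>. indicat_real B (X (n+1) \<omega>)) \<omega>)" for \<omega>
  have eq: "AE \<omega> in M. emeasure (\<alpha>s n \<omega>) B = g \<omega>"
    using predictive_cond_exp[OF n B] AE_space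
    by eventually_elim (simp add: g_def emeasure_predictive(1))
  have "AE \<omega> in M. g \<omega> = nn_cond_exp M (past M X n) (\<lambda>\<omega>. emeasure (\<alpha> \<omega>) B) \<omega>"
  proof (rule sigma_finite_subalgebra.nn_cond_exp_charact[OF sigma_finite_subalgebra_past])
    fix A assume A: "A \<in> sets (past M X n)"
    have "(\<integral>\<^sup>+\<omega>\<in>A. emeasure (\<alpha> \<omega>) B \<partial>M) = (\<integral>\<^sup>+\<omega>\<in>A. emeasure (\<alpha>s n \<omega>) B \<partial>M)"
      by (simp add: directing_set_integral[OF A B] predictive_set_integral[OF n A B])
    also have "\<dots> = (\<integral>\<^sup>+\<omega>\<in>A. g \<omega> \<partial>M)"
      using eq by (intro nn_integral_cong_AE) auto
    finally show "(\<integral>\<^sup>+\<omega>\<in>A. emeasure (\<alpha> \<omega>) B \<partial>M) = (\<integral>\<^sup>+\<omega>\<in>A. g \<omega> \<partial>M)" .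
  next
    show "(\<lambda>\<omega>. emeasure (\<alpha> \<omega>) B) \<in> borel_measurable M"
      using measurable_compose[OF measurable_prob_algebraD[OF kernel_directing] measurable_emeasure_subprob_algebra[OF B]] .
    show "g \<in> borel_measurable (past M X n)"
      unfolding g_def by measurable
  qed
  with eq show ?thesis by eventually_elim simp
qed

text \<open>Stage \<open>n\<close> is the past of the first \<open>Suc n\<close> variables. The
  shift matches the index set \<open>{1..}\<close> of the claim and the range in which
  \<open>predictive_eq_cond_exp_directing\<close> holds.\<close>

lemma measure_martingale_predictive:
  "measure_martingale M (\<lambda>n. past M X (Suc n)) \<alpha> (\<lambda>n. \<alpha>s (Suc n))"
  by unfold_locales
    (use subalgebra_past past_mono kernel_directing kernel_predictive predictive_eq_cond_exp_directing in auto)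

lemma directing_measurable_shifted:
  "\<alpha> \<in> sigma (space M) (\<Union>n. sets (past M X (Suc n))) \<rightarrow>\<^sub>M prob_algebra borel"
proof -
  have "(\<Union>n. sets (past M X n)) = (\<Union>n. sets (past M X (Suc n)))"
    using past_mono[OF le_SucI[OF order_refl]] by blast
  then show ?thesis using directing by (simp add: past_infinity_def)
qed

end

lemma SUP_atLeast_1: "(SUP n\<in>{1..}. g n) = (SUP n. g (Suc n))" for g :: "nat \<Rightarrow> 'b::complete_lattice"
proof -
  have "{1..} = range Suc" by (auto simp: image_iff) (metis Suc_le_D)
  then show ?thesis by (simp add: image_comp)
qed

theorem theorem4:
  fixes M :: "'w measure"
    and lam :: "'a::polish_space measure"
    and X :: "nat \<Rightarrow> 'w \<Rightarrow> 'a"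
    and \<alpha>s :: "nat \<Rightarrow> 'w \<Rightarrow> 'a measure"
    and \<alpha> :: "'w \<Rightarrow> 'a measure"
    and f :: "nat \<Rightarrow> 'w \<Rightarrow> 'a \<Rightarrow> real"
    and \<K> :: "'a set set"
  assumes "prob_space M"
    and "sets lam = sets borel"
    and "sigma_finite_measure lam"
    and "\<And>n. n \<ge> 1 \<Longrightarrow> X n \<in> M \<rightarrow>\<^sub>M borel"
    and "cond_ident_distr M X"
    and "\<And>n. n \<ge> 1 \<Longrightarrow> absolutely_continuous (Pi\<^sub>M {1..n} (\<lambda>_. lam))
            (distr M (Pi\<^sub>M {1..n} (\<lambda>_. borel)) (initial_segment X n))"
    and "predictive_measures M X \<alpha>s"
    and "\<And>n \<omega>. \<omega> \<in> space M \<Longrightarrow> f n \<omega> \<in> borel_measurable borel"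
    and "\<And>n \<omega> x. \<omega> \<in> space M \<Longrightarrow> 0 \<le> f n \<omega> x"
    and "\<And>n \<omega>. \<omega> \<in> space M \<Longrightarrow> \<alpha>s n \<omega> = density lam (\<lambda>x. ennreal (f n \<omega> x))"
    and "\<alpha> \<in> past_infinity M X \<rightarrow>\<^sub>M prob_algebra borel"
    and "AE \<omega> in M. converges_weakly (\<lambda>n. \<alpha>s n \<omega>) (\<alpha> \<omega>)"
    and "\<K> = {K. compact K \<and> emeasure lam K < \<infinity>}"
  shows "((AE \<omega> in M. absolutely_continuous lam (\<alpha> \<omega>)) \<longleftrightarrow>
           (\<forall>K\<in>\<K>. AE \<omega> in M. uniformly_integrable (trace_measure lam K) {1..} (\<lambda>n. f n \<omega>)))
    \<and> ((\<forall>K\<in>\<K>. \<exists>p>1. AE \<omega> in M. (SUP n\<in>{1..}. \<integral>\<^sup>+x\<in>K. ennreal (f n \<omega> x powr p) \<partial>lam) < \<infinity>) \<longrightarrow>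
           (AE \<omega> in M. absolutely_continuous lam (\<alpha> \<omega>)))
    \<and> (\<forall>K\<in>\<K>. \<forall>p>1.
           (SUP n\<in>{1..}. \<integral>\<^sup>+\<omega>. (\<integral>\<^sup>+x\<in>K. ennreal (f n \<omega> x powr p) \<partial>lam) \<partial>M) < \<infinity> \<longrightarrow>
           (AE \<omega> in M. (SUP n\<in>{1..}. \<integral>\<^sup>+x\<in>K. ennreal (f n \<omega> x powr p) \<partial>lam) < \<infinity>))"
proof (intro conjI iffI impI ballI allI)
  interpret predictive_process M X \<alpha>s \<alpha>
    using assms by (intro predictive_process.intro predictive_process_axioms.intro) auto
  interpret mm: measure_martingale M "\<lambda>n. past M X (Suc n)" \<alpha> "\<lambda>n. \<alpha>s (Suc n)"
    by (rule measure_martingale_predictive)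
  note sets_lam = assms(2) and sf = assms(3) and fm = assms(8) and f0 = assms(9) and fd = assms(10)
  have K: "compact K" "K \<in> sets borel" "emeasure lam K < \<infinity>" if "K \<in> \<K>" for K
    using that assms(13) by (auto intro: borel_compact)
  have fm': "f n \<omega> \<in> borel_measurable lam" if "\<omega> \<in> space M" for n \<omega>
    using fm[OF that] by (simp cong: measurable_cong_sets add: sets_lam)
  \<comment> \<open>Shared by the equivalence and the moment criterion, which reduces to it through
    \<open>uniformly_integrable_powr\<close>.\<close>
  have backward: "AE \<omega> in M. absolutely_continuous lam (\<alpha> \<omega>)"
    if ui: "\<And>K. K \<in> \<K> \<Longrightarrow> AE \<omega> in M. uniformly_integrable (trace_measure lam K) {1..} (\<lambda>n. f n \<omega>)"
  proof (rule mm.AE_kernel_absolutely_continuous[OF directing_measurable_shifted sets_lam sf])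
    show "AE \<omega> in M. \<forall>n. absolutely_continuous lam (\<alpha>s (Suc n) \<omega>)"
      using fm' by (intro AE_I2 allI) (auto simp: fd intro!: absolutely_continuousI_density)
    fix K :: "'a set" assume cK: "compact K" "emeasure lam K < \<infinity>"
    then have KK: "K \<in> \<K>" using assms(13) by auto
    show "AE \<omega> in M. \<forall>e::real>0. \<exists>d::real>0. \<forall>n. \<forall>B\<in>sets borel.
        emeasure lam (B \<inter> K) < ennreal d \<longrightarrow> emeasure (\<alpha>s (Suc n) \<omega>) (B \<inter> K) \<le> ennreal e"
      using ui[OF KK] AE_space
    proof eventually_elim
      case (elim \<omega>)
      show ?case
      proof (intro allI impI)
        fix e :: real assume e: "0 < e"
        have KL: "K \<in> sets lam" using K(2)[OF KK] sets_lam by simp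
        obtain d :: real where d: "0 < d" "\<And>n B. n \<in> {1..} \<Longrightarrow> B \<in> sets lam \<Longrightarrow> emeasure lam (B \<inter> K) < ennreal d \<Longrightarrow>
            emeasure (density lam (\<lambda>x. ennreal (f n \<omega> x))) (B \<inter> K) \<le> ennreal e"
          using uniformly_integrableD[OF elim(1) KL fm'[OF elim(2)] e] by blast
        show "\<exists>d::real>0. \<forall>n. \<forall>B\<in>sets borel.
            emeasure lam (B \<inter> K) < ennreal d \<longrightarrow> emeasure (\<alpha>s (Suc n) \<omega>) (B \<inter> K) \<le> ennreal e"
          using d by (intro exI[of _ d]) (simp add: fd[OF elim(2)] sets_lam)
      qed
    qed
  qed
  {
    assume ui: "\<forall>K\<in>\<K>. AE \<omega> in M. uniformly_integrable (trace_measure lam K) {1..} (\<lambda>n. f n \<omega>)"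
    show "AE \<omega> in M. absolutely_continuous lam (\<alpha> \<omega>)"
      by (rule backward) (use ui in blast)
  }
  {
    assume p: "\<forall>K\<in>\<K>. \<exists>p>1. AE \<omega> in M. (SUP n\<in>{1..}. \<integral>\<^sup>+x\<in>K. ennreal (f n \<omega> x powr p) \<partial>lam) < \<infinity>"
    show "AE \<omega> in M. absolutely_continuous lam (\<alpha> \<omega>)"
    proof (rule backward)
      fix K assume KK: "K \<in> \<K>"
      obtain p where p: "1 < p" "AE \<omega> in M. (SUP n\<in>{1..}. \<integral>\<^sup>+x\<in>K. ennreal (f n \<omega> x powr p) \<partial>lam) < \<infinity>"
        using p KK by blast
      show "AE \<omega> in M. uniformly_integrable (trace_measure lam K) {1..} (\<lambda>n. f n \<omega>)"
        using p(2) AE_space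
      proof eventually_elim
        case (elim \<omega>)
        show ?case
          by (rule uniformly_integrable_powr[OF _ fm'[OF elim(2)] p(1) elim(1)])
            (use K(2)[OF KK] sets_lam in simp)
      qed
    qed
  }
  {
    fix K assume ac: "AE \<omega> in M. absolutely_continuous lam (\<alpha> \<omega>)" and KK: "K \<in> \<K>"
    show "AE \<omega> in M. uniformly_integrable (trace_measure lam K) {1..} (\<lambda>n. f n \<omega>)"
      using mm.AE_kernels_equi_absolutely_continuous[OF sets_lam K(2,3)[OF KK] ac] AE_space
    proof eventually_elim
      case (elim \<omega>)
      show ?case
      proof (rule uniformly_integrableI)
        show "K \<in> sets lam" using K(2)[OF KK] sets_lam by simp
        show "f n \<omega> \<in> borel_measurable lam" for n by (rule fm'[OF elim(2)])
        show "emeasure (density lam (\<lambda>x. ennreal (f n \<omega> x))) (space lam) \<le> 1" if n: "n \<in> {1..}" for n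
        proof -
          obtain m where "n = Suc m" using n by (cases n) auto
          then show ?thesis
            using prob_space.emeasure_le_1[OF mm.prob_kernel(2)[OF elim(2)], of m "space lam"]
            by (simp add: fd[OF elim(2)])
        qed
        fix e :: real assume e: "0 < e"
        from elim(1)[rule_format, OF e] obtain d :: real where d: "0 < d"
          "\<forall>n. \<forall>B\<in>sets borel. emeasure lam (B \<inter> K) < ennreal d \<longrightarrow> emeasure (\<alpha>s (Suc n) \<omega>) (B \<inter> K) \<le> ennreal e"
          by (elim exE conjE)
        show "\<exists>d::real>0. \<forall>n\<in>{1..}. \<forall>B\<in>sets lam. emeasure lam (B \<inter> K) < ennreal d \<longrightarrow>
            emeasure (density lam (\<lambda>x. ennreal (f n \<omega> x))) (B \<inter> K) \<le> ennreal e"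
        proof (intro exI[of _ d] conjI ballI impI)
          fix n :: nat and B assume n: "n \<in> {1..}" and B: "B \<in> sets lam" "emeasure lam (B \<inter> K) < ennreal d"
          obtain m where m: "n = Suc m" using n by (cases n) auto
          have "B \<in> sets borel" using B(1) sets_lam by simp
          then show "emeasure (density lam (\<lambda>x. ennreal (f n \<omega> x))) (B \<inter> K) \<le> ennreal e"
            using d(2)[rule_format, of B m] B(2) by (simp add: fd[OF elim(2)] m)
        qed (rule d(1))
      qed
    qed
  }
  {
    fix K and p :: real
    assume KK: "K \<in> \<K>" and p: "1 < p"
      and fin: "(SUP n\<in>{1..}. \<integral>\<^sup>+\<omega>. (\<integral>\<^sup>+x\<in>K. ennreal (f n \<omega> x powr p) \<partial>lam) \<partial>M) < \<infinity>"
    show "AE \<omega> in M. (SUP n\<in>{1..}. \<integral>\<^sup>+x\<in>K. ennreal (f n \<omega> x powr p) \<partial>lam) < \<infinity>"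
      unfolding SUP_atLeast_1
    proof (rule mm.AE_SUP_powr_finite[OF sets_lam sf fm f0 fd K(2,3)[OF KK] p fin])
      show "(\<integral>\<^sup>+\<omega>. (\<integral>\<^sup>+x\<in>K. ennreal (f (Suc n) \<omega> x powr p) \<partial>lam) \<partial>M)
          \<le> (SUP n\<in>{1..}. \<integral>\<^sup>+\<omega>. (\<integral>\<^sup>+x\<in>K. ennreal (f n \<omega> x powr p) \<partial>lam) \<partial>M)" for n
        by (rule SUP_upper) simp
    qed
  }
qed

end
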